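(* Let $n,m\in\mathbb{N}$, let $f:\mathbb{R}^n\times\mathbb{R}^m\to\mathbb{R}^n$ and $r:\mathbb{R}^n\times\mathbb{R}^m\to\mathbb{R}$ be bounded and Lipschitz continuous, and let $\gamma>0$. For each $L>0$ let $Q^L=Q^L(x,a):\mathbb{R}^n\times\mathbb{R}^m\to\mathbb{R}$ be the bounded continuous viscosity solution of $$\gamma Q^L-D_xQ^L\cdot f(x,a)-L\|D_aQ^L\|_2-r(x,a)=0\quad\text{in }\mathbb{R}^n\times\mathbb{R}^m .$$ Then $$Q^L(x,a)\to Q(x)\quad\text{locally uniformly on }\mathbb{R}^n\times\mathbb{R}^m\text{ as }L\to\infty,$$ where $Q=Q(x)$ is the unique bounded continuous viscosity solution of $$\gamma Q-\sup_{a\in\mathbb{R}^m}\bigl(D_xQ\cdot f(x,a)+r(x,a)\bigr)=0\quad\text{in }\mathbb{R}^n .$$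
   Context: $\|\cdot\|_2$ is the Euclidean norm. It is known that these viscosity solutions are the value functions of the following discounted optimal control problems. With $\mathcal{A}$ the set of measurable functions $a(\cdot):[0,\infty)\to\mathbb{R}^m$ and $\mathcal{A}^L$ the set of those satisfying $\|a(s_1)-a(s_2)\|_2\le L|s_1-s_2|$ for all $s_1,s_2\ge0$, $$Q(x)=\sup_{a(\cdot)\in\mathcal{A}}\int_0^\infty e^{-\gamma s}r(x(s),a(s))\,ds,\qquad Q^L(x,a)=\sup_{a(\cdot)\in\mathcal{A}^L,\ a(0)=a}\int_0^\infty e^{-\gamma s}r(x(s),a(s))\,ds,$$ where $x'(s)=f(x(s),a(s))$ for $s>0$ and $x(0)=x$. *)

theory Defs
  imports "HOL-Analysis.Analysis"
begin

(* First-order equations F x (u x) (D u x) = 0 on the whole space. The sign convention is the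
   usual one for F nondecreasing in u: subsolutions satisfy F <= 0 where u - phi has a local
   maximum, supersolutions satisfy F >= 0 where u - phi has a local minimum, phi being of
   class C^1 with gradient g. *)

definition C1_with_gradient ::
  "('a::euclidean_space \<Rightarrow> real) \<Rightarrow> ('a \<Rightarrow> 'a) \<Rightarrow> bool" where
  "C1_with_gradient \<phi> g \<longleftrightarrow> (\<forall>y. GDERIV \<phi> y :> g y) \<and> continuous_on UNIV g"

definition viscosity_subsolution ::
  "('a::euclidean_space \<Rightarrow> real \<Rightarrow> 'a \<Rightarrow> real) \<Rightarrow> ('a \<Rightarrow> real) \<Rightarrow> bool" where
  "viscosity_subsolution F u \<longleftrightarrow>
    (\<forall>\<phi> g x. C1_with_gradient \<phi> g \<and>
       (\<forall>\<^sub>F y in nhds x. u y - \<phi> y \<le> u x - \<phi> x) \<longrightarrow> F x (u x) (g x) \<le> 0)"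

definition viscosity_supersolution ::
  "('a::euclidean_space \<Rightarrow> real \<Rightarrow> 'a \<Rightarrow> real) \<Rightarrow> ('a \<Rightarrow> real) \<Rightarrow> bool" where
  "viscosity_supersolution F u \<longleftrightarrow>
    (\<forall>\<phi> g x. C1_with_gradient \<phi> g \<and>
       (\<forall>\<^sub>F y in nhds x. u y - \<phi> y \<ge> u x - \<phi> x) \<longrightarrow> F x (u x) (g x) \<ge> 0)"

definition bounded_continuous_viscosity_solution ::
  "('a::euclidean_space \<Rightarrow> real \<Rightarrow> 'a \<Rightarrow> real) \<Rightarrow> ('a \<Rightarrow> real) \<Rightarrow> bool" where
  "bounded_continuous_viscosity_solution F u \<longleftrightarrow>
    bounded (range u) \<and> continuous_on UNIV u \<and>
    viscosity_subsolution F u \<and> viscosity_supersolution F u"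

(* The unknown lives on pairs (x, a), so its gradient is a pair (p, q) = (D_x, D_a). *)
definition HJB_rate_limited ::
  "((real^'n) \<times> (real^'m) \<Rightarrow> real^'n) \<Rightarrow> ((real^'n) \<times> (real^'m) \<Rightarrow> real) \<Rightarrow> real \<Rightarrow> real \<Rightarrow>
   (real^'n) \<times> (real^'m) \<Rightarrow> real \<Rightarrow> (real^'n) \<times> (real^'m) \<Rightarrow> real" where
  "HJB_rate_limited f r \<gamma> L = (\<lambda>(x, a) u (p, q). \<gamma> * u - p \<bullet> f (x, a) - L * norm q - r (x, a))"

(* The real-valued supremum is meaningful only when f and r are bounded. *)
definition HJB ::
  "((real^'n) \<times> (real^'m) \<Rightarrow> real^'n) \<Rightarrow> ((real^'n) \<times> (real^'m) \<Rightarrow> real) \<Rightarrow> real \<Rightarrow>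
   real^'n \<Rightarrow> real \<Rightarrow> real^'n \<Rightarrow> real" where
  "HJB f r \<gamma> = (\<lambda>x u p. \<gamma> * u - (SUP a. p \<bullet> f (x, a) + r (x, a)))"

end

theory Submission
  imports Defs
begin

text \<open>
  No control theory is needed. Let \<open>V\<close> be the lower half-relaxed limit of \<open>Q\<^sup>L\<close> as \<open>L \<rightarrow> \<infinity>\<close>.
  The equation is a supersolution inequality for every smaller rate \<open>L\<close> as well, so \<open>V\<close> satisfies
  \<open>L \<parallel>D\<^sub>a V\<parallel> \<le> \<gamma> V - D\<^sub>x V \<bullet> f - r\<close> for all \<open>L > 0\<close>; hence \<open>D\<^sub>a V = 0\<close>, i.e. \<open>V\<close> depends on \<open>x\<close> alone, and \<open>V\<close>
  is a supersolution of the limit equation. Conversely, for each \<open>L\<close> the upper semicontinuous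
  envelope \<open>W\<^sup>L\<close> of \<open>sup\<^sub>a Q\<^sup>L(\<cdot>, a)\<close> is a subsolution of the limit equation, and so is the envelope
  \<open>U\<close> of \<open>sup\<^sub>L W\<^sup>L\<close>. Comparison of semicontinuous sub- and supersolutions gives \<open>U \<le> V\<close>, while
  \<open>V \<le> U\<close> by construction. So \<open>Q = U = V\<close> exists and is unique; \<open>Q\<^sup>L \<le> Q\<close>, and the relaxed limit
  yields the lower bound uniformly on compact sets.
\<close>

subsection \<open>Lower semicontinuity\<close>

text \<open>Upper semicontinuity of \<open>u\<close> is expressed throughout as
  \<open>lsc (\<lambda>x. - u x)\<close>, so that one set of lemmas serves both notions.\<close>

definition lsc :: "('a::topological_space \<Rightarrow> real) \<Rightarrow> bool" where
  "lsc u \<longleftrightarrow> (\<forall>x c. c < u x \<longrightarrow> (\<forall>\<^sub>F y in nhds x. c < u y))"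

lemma lscD: "lsc u \<Longrightarrow> c < u x \<Longrightarrow> \<forall>\<^sub>F y in nhds x. c < u y"
  by (simp add: lsc_def)

lemma continuous_on_UNIV_tendsto:
  assumes "continuous_on UNIV h"
  shows "(h \<longlongrightarrow> h x) (nhds x)"
  using assms by (metis UNIV_I continuous_on_def filterlim_at_within_not_equal tendsto_at_iff_tendsto_nhds)

lemma lsc_compose:
  assumes "lsc u" "continuous_on UNIV h"
  shows "lsc (\<lambda>x. u (h x))"
proof -
  have "filterlim h (nhds (h x)) (nhds x)" for x
    by (rule continuous_on_UNIV_tendsto[OF assms(2)])
  then show ?thesis
    using assms(1) unfolding lsc_def filterlim_iff by blast
qed

lemma continuous_imp_lsc:
  fixes u :: "'a::topological_space \<Rightarrow> real"
  assumes "continuous_on UNIV u"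
  shows "lsc u"
proof -
  have "lsc (\<lambda>x::real. x)"
    unfolding lsc_def by (intro allI impI eventually_nhds_in_open[of "{_<..}", simplified]) auto
  from lsc_compose[OF this assms] show ?thesis .
qed

lemma lsc_add:
  assumes "lsc u" "lsc v"
  shows "lsc (\<lambda>x. u x + v x)"
  unfolding lsc_def
proof (intro allI impI)
  fix x c assume "c < u x + v x"
  define d where "d = (u x + v x - c) / 2"
  have "u x - d < u x" "v x - d < v x" "u x - d + (v x - d) = c"
    using \<open>c < u x + v x\<close> by (auto simp: d_def field_simps)
  then show "\<forall>\<^sub>F y in nhds x. c < u y + v y"
    using eventually_conj[OF lscD[OF assms(1), of "u x - d" x] lscD[OF assms(2), of "v x - d" x]]
    by (auto elim!: eventually_mono)
qed

lemma lsc_imp_continuous: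
  fixes u :: "'a::topological_space \<Rightarrow> real"
  assumes "lsc u" "lsc (\<lambda>x. - u x)"
  shows "continuous_on UNIV u"
  unfolding continuous_on_def
proof (intro ballI order_tendstoI)
  fix x c
  show "\<forall>\<^sub>F y in at x. c < u y" if "c < u x"
    using lscD[OF assms(1) that] by (simp add: eventually_nhds_conv_at)
  show "\<forall>\<^sub>F y in at x. u y < c" if "u x < c"
    using lscD[OF assms(2), of "-c" x] that by (simp add: eventually_nhds_conv_at)
qed

text \<open>Otherwise the open sets \<open>{x. u y < u x}\<close> with \<open>y \<in> K\<close>
  cover \<open>K\<close>; but among the indices of a finite subcover one with the least value lies
  in none of these sets.\<close>

lemma lsc_attains_inf:
  fixes u :: "'a::topological_space \<Rightarrow> real"
  assumes "lsc u" "compact K" "K \<noteq> {}"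
  shows "\<exists>x\<in>K. \<forall>y\<in>K. u x \<le> u y"
proof (rule ccontr)
  assume "\<not> ?thesis"
  then have *: "\<exists>y\<in>K. u y < u x" if "x \<in> K" for x
    using that by (force simp: not_le)
  have op: "open {x. c < u x}" for c
    using lscD[OF assms(1)] by (subst open_subopen) (auto simp: eventually_nhds subset_eq)
  have "K \<subseteq> (\<Union>y\<in>K. {x. u y < u x})"
    using * by auto
  then obtain D where D: "D \<subseteq> K" "finite D" "K \<subseteq> (\<Union>y\<in>D. {x. u y < u x})"
    using compactE_image[OF assms(2), of K "\<lambda>y. {x. u y < u x}"] op by metis
  then have "D \<noteq> {}"
    using assms(3) by auto
  then obtain z where z: "z \<in> D" "\<forall>y\<in>D. u z \<le> u y"
    using D(2) by (metis arg_min_least arg_min_if_finite(1))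
  then obtain y where "y \<in> D" "u y < u z"
    using D by auto
  with z show False
    by force
qed

text \<open>Points outside the closure of the sublevel set have values above \<open>u x0\<close>, so
  the minimum over this compact closure is global.\<close>

lemma lsc_attains_inf_UNIV:
  fixes u :: "'a::heine_borel \<Rightarrow> real"
  assumes "lsc u" "bounded {y. u y \<le> u x0}"
  shows "\<exists>x. \<forall>y. u x \<le> u y"
proof -
  have "x0 \<in> closure {y. u y \<le> u x0}"
    using closure_subset by fastforce
  moreover have "compact (closure {y. u y \<le> u x0})"
    using assms(2) by simp
  ultimately obtain x where "\<forall>y\<in>closure {y. u y \<le> u x0}. u x \<le> u y"
    using lsc_attains_inf[OF assms(1)] by blast
  then have "u x \<le> u y" for y
    using closure_subset[of "{y. u y \<le> u x0}"] \<open>x0 \<in> _\<close> by (cases "u y \<le> u x0") force+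
  then show ?thesis
    by blast
qed

subsection \<open>Test functions\<close>

lemma C1_add:
  assumes "C1_with_gradient \<phi> g" "C1_with_gradient \<psi> h"
  shows "C1_with_gradient (\<lambda>x. \<phi> x + \<psi> x) (\<lambda>x. g x + h x)"
  using assms unfolding C1_with_gradient_def
  by (auto intro: GDERIV_add continuous_intros)

lemma C1_minus:
  assumes "C1_with_gradient \<phi> g"
  shows "C1_with_gradient (\<lambda>x. - \<phi> x) (\<lambda>x. - g x)"
  using assms unfolding C1_with_gradient_def
  by (auto intro: GDERIV_minus continuous_intros)

lemma C1_scale:
  assumes "C1_with_gradient \<phi> g"
  shows "C1_with_gradient (\<lambda>x. c * \<phi> x) (\<lambda>x. c *\<^sub>R g x)"
proof -
  have "GDERIV (\<lambda>x. c * \<phi> x) x :> c *\<^sub>R g x" for x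
    using assms GDERIV_mult[OF GDERIV_const[of c x], of \<phi> "g x"]
    by (simp add: C1_with_gradient_def)
  then show ?thesis
    using assms by (auto simp: C1_with_gradient_def intro: continuous_intros)
qed

lemma C1_const: "C1_with_gradient (\<lambda>x. c) (\<lambda>x. 0)"
  by (simp add: C1_with_gradient_def GDERIV_const)

lemma C1_shift:
  assumes "C1_with_gradient \<phi> g"
  shows "C1_with_gradient (\<lambda>x. \<phi> (x + c)) (\<lambda>x. g (x + c))"
proof -
  have "GDERIV (\<lambda>x. \<phi> (x + c)) x :> g (x + c)" for x
  proof -
    have "((\<lambda>x. x + c) has_derivative (\<lambda>h. h)) (at x)"
      by (auto intro!: derivative_eq_intros)
    from has_derivative_compose[OF this, of \<phi> "\<lambda>h. h \<bullet> g (x + c)"]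
    show ?thesis
      using assms by (simp add: C1_with_gradient_def gderiv_def)
  qed
  moreover have "continuous_on UNIV (\<lambda>x. g (x + c))"
    using assms by (auto simp: C1_with_gradient_def intro!: continuous_on_compose2[of UNIV g] continuous_intros)
  ultimately show ?thesis
    by (simp add: C1_with_gradient_def)
qed

lemma C1_fst:
  assumes "C1_with_gradient \<phi> g"
  shows "C1_with_gradient (\<lambda>z. \<phi> (fst z)) (\<lambda>z::'a::euclidean_space \<times> 'b::euclidean_space. (g (fst z), 0))"
proof -
  have "GDERIV (\<lambda>z. \<phi> (fst z)) z :> (g (fst z), 0)" for z :: "'a \<times> 'b"
  proof -
    have "(fst has_derivative fst) (at z)"
      by (auto intro!: derivative_eq_intros)
    from has_derivative_compose[OF this, of \<phi> "\<lambda>h. h \<bullet> g (fst z)"]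
    show ?thesis
      using assms by (simp add: C1_with_gradient_def gderiv_def inner_prod_def)
  qed
  moreover have "continuous_on UNIV (\<lambda>z::'a \<times> 'b. (g (fst z), 0::'b))"
    using assms by (auto simp: C1_with_gradient_def intro!: continuous_on_Pair continuous_on_compose2[of UNIV g] continuous_intros)
  ultimately show ?thesis
    by (simp add: C1_with_gradient_def)
qed

lemma C1_snd:
  assumes "C1_with_gradient \<phi> g"
  shows "C1_with_gradient (\<lambda>z. \<phi> (snd z)) (\<lambda>z::'a::euclidean_space \<times> 'b::euclidean_space. (0, g (snd z)))"
proof -
  have "GDERIV (\<lambda>z. \<phi> (snd z)) z :> (0, g (snd z))" for z :: "'a \<times> 'b"
  proof -
    have "(snd has_derivative snd) (at z)"
      by (auto intro!: derivative_eq_intros)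
    from has_derivative_compose[OF this, of \<phi> "\<lambda>h. h \<bullet> g (snd z)"]
    show ?thesis
      using assms by (simp add: C1_with_gradient_def gderiv_def inner_prod_def)
  qed
  moreover have "continuous_on UNIV (\<lambda>z::'a \<times> 'b. (0::'a, g (snd z)))"
    using assms by (auto simp: C1_with_gradient_def intro!: continuous_on_Pair continuous_on_compose2[of UNIV g] continuous_intros)
  ultimately show ?thesis
    by (simp add: C1_with_gradient_def)
qed

lemma C1_norm_sq: "C1_with_gradient (\<lambda>x. (norm (x - c))\<^sup>2) (\<lambda>x. 2 *\<^sub>R (x - c))"
proof -
  have "GDERIV (\<lambda>x. (norm (x - c))\<^sup>2) x :> 2 *\<^sub>R (x - c)" for x
    unfolding gderiv_def power2_norm_eq_inner
    by (auto intro!: derivative_eq_intros simp: inner_commute algebra_simps fun_eq_iff)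
  then show ?thesis
    by (simp add: C1_with_gradient_def continuous_intros)
qed

text \<open>A smooth substitute for the norm: linear growth makes functionals coercive, while the
  gradient stays in the unit ball, so that a small multiple perturbs gradients little, uniformly in
  space.\<close>

definition jnorm :: "'a::euclidean_space \<Rightarrow> real" where
  "jnorm x = sqrt (1 + (norm x)\<^sup>2)"

lemma jnorm_pos: "0 < jnorm x"
  by (simp add: jnorm_def add_pos_nonneg)

lemma norm_less_jnorm: "norm x < jnorm x"
  unfolding jnorm_def by (rule real_less_rsqrt) simp

lemma jnorm_0: "jnorm 0 = 1"
  by (simp add: jnorm_def)

lemma continuous_on_jnorm [continuous_intros]:
  "continuous_on S f \<Longrightarrow> continuous_on S (\<lambda>x. jnorm (f x))"
  unfolding jnorm_def by (intro continuous_intros)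

lemma C1_jnorm: "C1_with_gradient (\<lambda>x. jnorm (x - c)) (\<lambda>x. inverse (jnorm (x - c)) *\<^sub>R (x - c))"
proof -
  have "GDERIV (\<lambda>x. jnorm (x - c)) x :> inverse (jnorm (x - c)) *\<^sub>R (x - c)" for x
  proof -
    have pos: "0 < 1 + (norm (x - c))\<^sup>2"
      by (simp add: add_pos_nonneg)
    have "GDERIV (\<lambda>x. 1 + (norm (x - c))\<^sup>2) x :> 2 *\<^sub>R (x - c)"
      using C1_add[OF C1_const[of 1] C1_norm_sq[of c]] by (simp add: C1_with_gradient_def)
    from GDERIV_DERIV_compose[OF this DERIV_real_sqrt[OF pos]]
    show ?thesis
      by (simp add: jnorm_def inverse_eq_divide)
  qed
  moreover have "continuous_on UNIV (\<lambda>x. inverse (jnorm (x - c)) *\<^sub>R (x - c))"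
    by (auto intro!: continuous_intros simp: less_imp_neq[OF jnorm_pos, symmetric])
  ultimately show ?thesis
    by (simp add: C1_with_gradient_def)
qed

lemma norm_jnorm_gradient: "norm (inverse (jnorm x) *\<^sub>R x) \<le> 1"
  using norm_less_jnorm[of x] jnorm_pos[of x] by (simp add: field_simps)

lemma C1_imp_continuous:
  assumes "C1_with_gradient \<phi> g"
  shows "continuous_on UNIV \<phi>"
  using assms unfolding C1_with_gradient_def gderiv_def
  by (meson continuous_at_imp_continuous_on has_derivative_continuous)

lemma C1_gradient_at_local_max:
  assumes "C1_with_gradient \<phi> g" "\<forall>\<^sub>F y in nhds x. \<phi> y \<le> \<phi> x"
  shows "g x = 0"
proof -
  obtain S where S: "open S" "x \<in> S" "\<And>y. y \<in> S \<Longrightarrow> \<phi> y \<le> \<phi> x"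
    using assms(2) unfolding eventually_nhds by blast
  have "(\<phi> has_derivative (\<lambda>h. h \<bullet> g x)) (at x)"
    using assms(1) by (simp add: C1_with_gradient_def gderiv_def)
  from differential_zero_maxmin[OF S(2,1) this] S(3)
  have "g x \<bullet> g x = 0"
    by metis
  then show ?thesis
    by simp
qed

subsection \<open>Comparison principle\<close>

text \<open>The regularity on which comparison and stability rest: \<open>x = y\<close> gives
  Lipschitz dependence on the gradient with constant \<open>M\<close>, and \<open>q = 0\<close> a
  Lipschitz estimate in the point whose constant grows linearly with the gradient.\<close>

definition structured :: "real \<Rightarrow> real \<Rightarrow> ('a::euclidean_space \<Rightarrow> 'a \<Rightarrow> real) \<Rightarrow> bool" where
  "structured M C H \<longleftrightarrow>
    (\<forall>x y p q. H x (p + q) \<le> H y p + M * norm q + C * (1 + norm p) * dist x y)"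

lemma structuredD:
  "structured M C H \<Longrightarrow> H x (p + q) \<le> H y p + M * norm q + C * (1 + norm p) * dist x y"
  by (simp add: structured_def)

text \<open>A test function touching a constant has zero gradient there, so only
  \<open>H x 0\<close> matters. Constants are the barriers for the a priori bound.\<close>

lemma viscosity_subsolution_const:
  fixes H :: "'a::euclidean_space \<Rightarrow> 'a \<Rightarrow> real"
  assumes "\<And>x. \<gamma> * c \<le> H x 0"
  shows "viscosity_subsolution (\<lambda>x s p. \<gamma> * s - H x p) (\<lambda>x. c)"
  unfolding viscosity_subsolution_def
proof (intro allI impI, elim conjE)
  fix \<phi> :: "'a \<Rightarrow> real" and g x
  assume "C1_with_gradient \<phi> g" "\<forall>\<^sub>F y in nhds x. c - \<phi> y \<le> c - \<phi> x"
  from C1_gradient_at_local_max[OF C1_minus[OF this(1)], of x] this(2)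
  have "g x = 0"
    by simp
  then show "\<gamma> * c - H x (g x) \<le> 0"
    using assms by simp
qed

lemma viscosity_supersolution_const:
  fixes H :: "'a::euclidean_space \<Rightarrow> 'a \<Rightarrow> real"
  assumes "\<And>x. H x 0 \<le> \<gamma> * c"
  shows "viscosity_supersolution (\<lambda>x s p. \<gamma> * s - H x p) (\<lambda>x. c)"
  unfolding viscosity_supersolution_def
proof (intro allI impI, elim conjE)
  fix \<phi> :: "'a \<Rightarrow> real" and g x
  assume "C1_with_gradient \<phi> g" "\<forall>\<^sub>F y in nhds x. c - \<phi> x \<le> c - \<phi> y"
  from C1_gradient_at_local_max[OF this(1), of x] this(2)
  have "g x = 0"
    by simp
  then show "0 \<le> \<gamma> * c - H x (g x)"
    using assms by simp
qed

lemma viscosity_subsolutionD: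
  assumes "viscosity_subsolution F u" "C1_with_gradient \<phi> g" "\<And>y. u y - \<phi> y \<le> u x - \<phi> x"
  shows "F x (u x) (g x) \<le> 0"
  using assms unfolding viscosity_subsolution_def by (metis (mono_tags, lifting) always_eventually)

lemma viscosity_supersolutionD:
  assumes "viscosity_supersolution F u" "C1_with_gradient \<phi> g" "\<And>y. u x - \<phi> x \<le> u y - \<phi> y"
  shows "0 \<le> F x (u x) (g x)"
  using assms unfolding viscosity_supersolution_def by (metis (mono_tags, lifting) always_eventually)

text \<open>Doubling of variables for semicontinuous functions. As the weight runs through powers of
  2, the minimal values increase and stay bounded, so their increments become small; an increment
  dominates the quadratic penalty at the next minimizer.\<close>

lemma penalized_minimizer:
  fixes u v :: "'a::euclidean_space \<Rightarrow> real"
  assumes u: "lsc (\<lambda>x. - u x)" "\<And>x. u x \<le> B" and v: "lsc v" "\<And>x. - B \<le> v x"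
    and "\<epsilon> > 0" "\<eta> > 0"
  obtains K x y where "K \<ge> 1" "K * (norm (x - y))\<^sup>2 \<le> \<eta>"
    "\<And>x' y'. v y - u x + K * (norm (x - y))\<^sup>2 + \<epsilon> * jnorm x
           \<le> v y' - u x' + K * (norm (x' - y'))\<^sup>2 + \<epsilon> * jnorm x'"
proof -
  define W where "W k z = v (snd z) - u (fst z) + 2 ^ k * (norm (fst z - snd z))\<^sup>2 + \<epsilon> * jnorm (fst z)"
    for k :: nat and z :: "'a \<times> 'a"
  have "\<exists>z. \<forall>z'. W k z \<le> W k z'" for k
  proof (rule lsc_attains_inf_UNIV)
    have "lsc (\<lambda>z::'a \<times> 'a. (v (snd z) + - u (fst z)) + (2 ^ k * (norm (fst z - snd z))\<^sup>2 + \<epsilon> * jnorm (fst z)))"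
      by (intro lsc_add lsc_compose[OF v(1)] lsc_compose[OF u(1)] continuous_imp_lsc continuous_intros)
    then show "lsc (W k)"
      by (simp add: W_def[abs_def] add.assoc)
    define c where "c = W k (0, 0) + 2 * B"
    have "norm (x, y) \<le> 2 * (c / \<epsilon>) + (1 + c)" if le: "W k (x, y) \<le> W k (0, 0)" for x y
    proof -
      have "2 ^ k * (norm (x - y))\<^sup>2 \<ge> (norm (x - y))\<^sup>2"
        by (simp add: mult_le_cancel_right1)
      with le u(2)[of x] v(2)[of y] have *: "(norm (x - y))\<^sup>2 + \<epsilon> * jnorm x \<le> c"
        unfolding W_def c_def by simp
      have pos: "0 \<le> \<epsilon> * jnorm x"
        using jnorm_pos[of x] \<open>\<epsilon> > 0\<close> by simp
      have "\<epsilon> * norm x \<le> \<epsilon> * jnorm x"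
        using norm_less_jnorm[of x] \<open>\<epsilon> > 0\<close> by simp
      also have "\<dots> \<le> c"
        using * zero_le_power2[of "norm (x - y)"] by linarith
      finally have 1: "norm x \<le> c / \<epsilon>"
        using \<open>\<epsilon> > 0\<close> by (simp add: field_simps)
      \<comment> \<open>This turns the bound on the square into one on the norm, which together with
        the bound on \<open>x\<close> gives coercivity in both variables.\<close>
      have "2 * norm (x - y) \<le> 1 + (norm (x - y))\<^sup>2"
        using zero_le_power2[of "norm (x - y) - 1"] by (simp add: power2_diff)
      then have 2: "norm (x - y) \<le> 1 + c"
        using * pos by (smt (verit) norm_ge_zero)
      have "norm (x, y) \<le> norm x + norm y"
        by (rule norm_Pair_le)
      also have "norm y \<le> norm x + norm (x - y)"
        by (metis norm_minus_commute norm_triangle_sub)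
      finally show ?thesis
        using 1 2 by linarith
    qed
    then show "bounded {z. W k z \<le> W k (0, 0)}"
      unfolding bounded_iff by (intro exI[of _ "2 * (c / \<epsilon>) + (1 + c)"]) auto
  qed
  then obtain z where z: "\<And>k z'. W k (z k) \<le> W k z'"
    by metis
  define m where "m k = W k (z k)" for k
  \<comment> \<open>The minimizer for weight \<open>2 ^ Suc k\<close> competes in the problem for
    weight \<open>2 ^ k\<close>; the two functionals differ exactly by \<open>2 ^ k\<close> times
    the squared distance.\<close>
  have step: "m k + 2 ^ k * (norm (fst (z (Suc k)) - snd (z (Suc k))))\<^sup>2 \<le> m (Suc k)" for k
    using z[of k "z (Suc k)"] by (simp add: m_def W_def)
  have "m k \<le> m (Suc k)" for k
    using step[of k] by (smt (verit) mult_nonneg_nonneg zero_le_power zero_le_power2)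
  then have "incseq m"
    by (rule incseq_SucI)
  moreover have "m k \<le> W 0 (0, 0)" for k
    using z[of k "(0, 0)"] by (simp add: m_def W_def)
  ultimately obtain l where "m \<longlonglongrightarrow> l"
    using incseq_convergent by blast
  then have "(\<lambda>k. m (Suc k) - m k) \<longlonglongrightarrow> l - l"
    by (intro tendsto_diff LIMSEQ_Suc)
  \<comment> \<open>Half of \<open>\<eta>\<close>, because the increment controls
    \<open>2 ^ k\<close> times the square whereas the weight delivered is
    \<open>2 ^ Suc k\<close>.\<close>
  then have "\<forall>\<^sub>F k in sequentially. m (Suc k) - m k < \<eta> / 2"
    using \<open>\<eta> > 0\<close> by (intro order_tendstoD(2)) auto
  then obtain k where k: "m (Suc k) - m k < \<eta> / 2"
    by (auto simp: eventually_sequentially)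
  show ?thesis
  proof (rule that)
    show "(1::real) \<le> 2 ^ Suc k"
      by (rule one_le_power) simp
    show "2 ^ Suc k * (norm (fst (z (Suc k)) - snd (z (Suc k))))\<^sup>2 \<le> \<eta>"
      using k step[of k] by simp
    show "v (snd (z (Suc k))) - u (fst (z (Suc k))) + 2 ^ Suc k * (norm (fst (z (Suc k)) - snd (z (Suc k))))\<^sup>2
        + \<epsilon> * jnorm (fst (z (Suc k)))
        \<le> v y' - u x' + 2 ^ Suc k * (norm (x' - y'))\<^sup>2 + \<epsilon> * jnorm x'" for x' y'
      using z[of "Suc k" "(x', y')"] by (simp add: W_def)
  qed
qed

text \<open>At a minimizer of the doubled functional, \<open>u\<close> and \<open>v\<close> are
  touched with gradients \<open>p + \<epsilon> *\<^sub>R e\<close> and \<open>p\<close>. Subtracting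
  the two viscosity inequalities makes \<open>\<gamma> * (u x - v y)\<close> small, while minimality
  keeps \<open>u x - v y\<close> close to the assumed positive gap \<open>d\<close>.\<close>

theorem comparison:
  fixes u v :: "'a::euclidean_space \<Rightarrow> real"
  assumes "\<gamma> > 0" "M \<ge> 0" "C \<ge> 0" and H: "structured M C H"
    and u: "lsc (\<lambda>x. - u x)" "\<And>x. u x \<le> B" "viscosity_subsolution (\<lambda>x s p. \<gamma> * s - H x p) u"
    and v: "lsc v" "\<And>x. - B \<le> v x" "viscosity_supersolution (\<lambda>x s p. \<gamma> * s - H x p) v"
  shows "u x0 \<le> v x0"
proof (rule ccontr)
  define d where "d = u x0 - v x0"
  assume "\<not> u x0 \<le> v x0"
  then have "d > 0"
    by (simp add: d_def)
  \<comment> \<open>The first bound limits the penalty at \<open>x0\<close> to \<open>d / 4\<close>,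
    the second the error from its gradient to \<open>\<gamma> * d / 8\<close>; \<open>M + 1\<close>
    keeps the divisor positive.\<close>
  define \<epsilon> where "\<epsilon> = min (d / 4 / jnorm x0) (\<gamma> * d / 8 / (M + 1))"
  have \<epsilon>: "\<epsilon> > 0" "\<epsilon> * jnorm x0 \<le> d / 4" "M * \<epsilon> \<le> \<gamma> * d / 8"
  proof -
    show "\<epsilon> > 0"
      using \<open>d > 0\<close> \<open>\<gamma> > 0\<close> \<open>M \<ge> 0\<close> jnorm_pos[of x0] by (simp add: \<epsilon>_def)
    have "\<epsilon> \<le> d / 4 / jnorm x0"
      by (simp add: \<epsilon>_def)
    then show "\<epsilon> * jnorm x0 \<le> d / 4"
      using jnorm_pos[of x0] by (simp add: pos_le_divide_eq)
    have "\<epsilon> \<le> \<gamma> * d / 8 / (M + 1)"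
      by (simp add: \<epsilon>_def)
    then have "\<epsilon> * (M + 1) \<le> \<gamma> * d / 8"
      using \<open>M \<ge> 0\<close> by (simp add: pos_le_divide_eq algebra_simps)
    then show "M * \<epsilon> \<le> \<gamma> * d / 8"
      using \<open>\<epsilon> > 0\<close> by (simp add: algebra_simps)
  qed
  \<comment> \<open>With tolerance \<open>\<eta>\<^sup>2\<close> for the quadratic penalty, both
    \<open>norm (x - y)\<close> and \<open>K * (norm (x - y))\<^sup>2\<close> are at most
    \<open>\<eta>\<close>, so the error from moving the base point is at most
    \<open>3 * C * \<eta>\<close>.\<close>
  define \<eta> where "\<eta> = min 1 (\<gamma> * d / 8 / (3 * (C + 1)))"
  have \<eta>: "\<eta> > 0" "\<eta> \<le> 1" "3 * C * \<eta> \<le> \<gamma> * d / 8"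
  proof -
    show "\<eta> > 0" "\<eta> \<le> 1"
      using \<open>d > 0\<close> \<open>\<gamma> > 0\<close> \<open>C \<ge> 0\<close> by (simp_all add: \<eta>_def)
    have "\<eta> \<le> \<gamma> * d / 8 / (3 * (C + 1))"
      by (simp add: \<eta>_def)
    then have "\<eta> * (3 * (C + 1)) \<le> \<gamma> * d / 8"
      using \<open>C \<ge> 0\<close> by (simp add: pos_le_divide_eq algebra_simps)
    then show "3 * C * \<eta> \<le> \<gamma> * d / 8"
      using \<open>\<eta> > 0\<close> by (simp add: algebra_simps)
  qed
  have "0 < \<eta>\<^sup>2"
    using \<eta>(1) by simp
  obtain K x y where K: "K \<ge> 1" "K * (norm (x - y))\<^sup>2 \<le> \<eta>\<^sup>2"
    and min: "\<And>x' y'. v y - u x + K * (norm (x - y))\<^sup>2 + \<epsilon> * jnorm x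
                \<le> v y' - u x' + K * (norm (x' - y'))\<^sup>2 + \<epsilon> * jnorm x'"
    by (rule penalized_minimizer[OF u(1,2) v(1,2) \<epsilon>(1) \<open>0 < \<eta>\<^sup>2\<close>]) (rule that)
  define p where "p = (2 * K) *\<^sub>R (x - y)"
  define e where "e = inverse (jnorm x) *\<^sub>R x"
  have "C1_with_gradient (\<lambda>z. K * (norm (z - y))\<^sup>2 + \<epsilon> * jnorm (z - 0))
      (\<lambda>z. K *\<^sub>R (2 *\<^sub>R (z - y)) + \<epsilon> *\<^sub>R (inverse (jnorm (z - 0)) *\<^sub>R (z - 0)))"
    by (intro C1_add C1_scale C1_norm_sq C1_jnorm)
  from viscosity_subsolutionD[OF u(3) this, of x] min[where y' = y]
  have "\<gamma> * u x \<le> H x (p + \<epsilon> *\<^sub>R e)"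
    by (simp add: p_def e_def algebra_simps)
  also have "\<dots> \<le> H y p + M * norm (\<epsilon> *\<^sub>R e) + C * (1 + norm p) * dist x y"
    by (rule structuredD[OF H])
  also have "H y p \<le> \<gamma> * v y"
  proof -
    have "C1_with_gradient (\<lambda>z. (- K) * (norm (z - x))\<^sup>2) (\<lambda>z. (- K) *\<^sub>R (2 *\<^sub>R (z - x)))"
      by (intro C1_scale C1_norm_sq)
    from viscosity_supersolutionD[OF v(3) this, of y] min[where x' = x]
    show ?thesis
      by (simp add: p_def norm_minus_commute algebra_simps)
  qed
  also have "M * norm (\<epsilon> *\<^sub>R e) \<le> \<gamma> * d / 8"
  proof -
    have "norm (\<epsilon> *\<^sub>R e) \<le> \<epsilon>"
      using norm_jnorm_gradient[of x, folded e_def] \<epsilon>(1) by (simp add: mult_left_le)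
    then show ?thesis
      using \<epsilon>(3) \<open>M \<ge> 0\<close> by (meson mult_left_mono order_trans)
  qed
  also have "C * (1 + norm p) * dist x y \<le> \<gamma> * d / 8"
  proof -
    have "(norm (x - y))\<^sup>2 \<le> K * (norm (x - y))\<^sup>2"
      using K(1) by (simp add: mult_le_cancel_right1)
    then have "norm (x - y) \<le> \<eta>"
      using K(2) \<eta>(1) by (meson order_trans power2_le_imp_le less_imp_le)
    moreover have "\<eta>\<^sup>2 \<le> \<eta>"
      using \<eta>(1,2) by (simp add: power2_eq_square mult_left_le)
    moreover have "norm p = 2 * K * norm (x - y)"
      using K(1) by (simp add: p_def)
    then have "(1 + norm p) * dist x y = norm (x - y) + 2 * (K * (norm (x - y))\<^sup>2)"
      by (simp only: dist_norm power2_eq_square) (simp only: algebra_simps)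
    ultimately have "(1 + norm p) * dist x y \<le> 3 * \<eta>"
      using K(2) by linarith
    then have "C * ((1 + norm p) * dist x y) \<le> C * (3 * \<eta>)"
      using \<open>C \<ge> 0\<close> by (rule mult_left_mono)
    also have "\<dots> \<le> \<gamma> * d / 8"
      using \<eta>(3) by (simp add: ac_simps)
    finally show ?thesis
      by (simp only: mult.assoc)
  qed
  finally have "\<gamma> * (u x - v y) \<le> \<gamma> * (d / 4)"
    by (simp add: algebra_simps)
  then have "u x - v y \<le> d / 4"
    using \<open>\<gamma> > 0\<close> by simp
  \<comment> \<open>The competitor is the diagonal point \<open>(x0, x0)\<close>, where only the
    penalty \<open>\<epsilon> * jnorm x0\<close> remains.\<close>
  moreover have "d - d / 4 \<le> u x - v y"
  proof -
    have "0 \<le> K * (norm (x - y))\<^sup>2 + \<epsilon> * jnorm x"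
      using K(1) \<epsilon>(1) jnorm_pos[of x] by simp
    moreover have "v y - u x + K * (norm (x - y))\<^sup>2 + \<epsilon> * jnorm x \<le> v x0 - u x0 + \<epsilon> * jnorm x0"
      using min[of x0 x0] by simp
    ultimately show ?thesis
      using \<epsilon>(2) unfolding d_def by linarith
  qed
  ultimately show False
    using \<open>d > 0\<close> by simp
qed

subsection \<open>Half-relaxed limits\<close>

text \<open>Over the reals this \<open>Sup\<close> is meaningful only if \<open>F\<close> is proper and \<open>u\<close> is eventually bounded.\<close>

definition lower_limit :: "'i filter \<Rightarrow> ('i \<Rightarrow> 'a::topological_space \<Rightarrow> real) \<Rightarrow> 'a \<Rightarrow> real" where
  "lower_limit F u z = Sup {c. \<forall>\<^sub>F (i, y) in F \<times>\<^sub>F nhds z. c < u i y}"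

definition upper_limit :: "'i filter \<Rightarrow> ('i \<Rightarrow> 'a::topological_space \<Rightarrow> real) \<Rightarrow> 'a \<Rightarrow> real" where
  "upper_limit F u z = - lower_limit F (\<lambda>i y. - u i y) z"

context
  fixes F :: "'i filter" and u :: "'i \<Rightarrow> 'a::topological_space \<Rightarrow> real" and B :: real
  assumes bounds: "\<forall>\<^sub>F i in F. \<forall>y. \<bar>u i y\<bar> \<le> B" and nontriv: "F \<noteq> bot"
begin

lemma ev_above_lower_bound:
  assumes "c < - B"
  shows "\<forall>\<^sub>F (i, y) in F \<times>\<^sub>F nhds z. c < u i y"
  unfolding eventually_prod_filter split_conv
proof (intro exI conjI allI impI)
  show "\<forall>\<^sub>F i in F. \<forall>y. \<bar>u i y\<bar> \<le> B" "\<forall>\<^sub>F y in nhds z. True"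
    using bounds by simp_all
  show "c < u i y" if "\<forall>y. \<bar>u i y\<bar> \<le> B" for i y
    using that[rule_format, of y] assms by linarith
qed

lemma ev_above_imp_le:
  assumes "\<forall>\<^sub>F (i, y) in F \<times>\<^sub>F nhds z. c < u i y"
  shows "c \<le> B"
proof -
  have "\<forall>\<^sub>F i in F. \<forall>\<^sub>F y in nhds z. c < u i y"
    using eventually_eventually_prod_filter1[OF assms] by simp
  from eventually_happens'[OF nontriv eventually_conj[OF this bounds]]
  obtain i where "\<forall>\<^sub>F y in nhds z. c < u i y" "\<forall>y. \<bar>u i y\<bar> \<le> B"
    by blast
  then have "c < u i z" "\<bar>u i z\<bar> \<le> B"
    using eventually_nhds_x_imp_x by blast+
  then show ?thesis
    by linarith
qed

lemma lower_limit_gtD: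
  assumes "c < lower_limit F u z"
  shows "\<forall>\<^sub>F (i, y) in F \<times>\<^sub>F nhds z. c < u i y"
proof -
  have "{c. \<forall>\<^sub>F (i, y) in F \<times>\<^sub>F nhds z. c < u i y} \<noteq> {}"
    using ev_above_lower_bound[of "- B - 1"] by auto
  from less_cSupE[OF assms[unfolded lower_limit_def] this]
  obtain c' where "c < c'" "\<forall>\<^sub>F (i, y) in F \<times>\<^sub>F nhds z. c' < u i y"
    by blast
  then show ?thesis
    by (auto elim!: eventually_mono)
qed

lemma lower_limit_geI:
  assumes "\<forall>\<^sub>F (i, y) in F \<times>\<^sub>F nhds z. c < u i y"
  shows "c \<le> lower_limit F u z"
  unfolding lower_limit_def
proof (rule cSup_upper)
  show "bdd_above {c. \<forall>\<^sub>F (i, y) in F \<times>\<^sub>F nhds z. c < u i y}"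
    using ev_above_imp_le by (intro bdd_aboveI[of _ B]) blast
qed (use assms in simp)

lemma abs_lower_limit_le: "\<bar>lower_limit F u z\<bar> \<le> B"
proof -
  have "- B \<le> lower_limit F u z"
    using lower_limit_geI[OF ev_above_lower_bound] by (rule dense_le)
  moreover have "lower_limit F u z \<le> B"
    using ev_above_imp_le[OF lower_limit_gtD] by (rule dense_le)
  ultimately show ?thesis
    by linarith
qed

lemma lsc_lower_limit: "lsc (lower_limit F u)"
  unfolding lsc_def
proof (intro allI impI)
  fix z c assume "c < lower_limit F u z"
  then obtain c' where c': "c < c'" "c' < lower_limit F u z"
    using dense by blast
  from lower_limit_gtD[OF c'(2)] obtain P Q where PQ: "eventually P F" "eventually Q (nhds z)"
      "\<And>i y. P i \<Longrightarrow> Q y \<Longrightarrow> c' < u i y"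
    unfolding eventually_prod_filter split_conv by blast
  \<comment> \<open>A neighbourhood of \<open>z\<close> is also one of all points near
    \<open>z\<close>, so the same \<open>P\<close>, \<open>Q\<close> and \<open>c'\<close> serve
    there. The gap between \<open>c\<close> and \<open>c'\<close> restores strictness.\<close>
  from PQ(2) have "\<forall>\<^sub>F y in nhds z. eventually Q (nhds y)"
    by (simp add: eventually_eventually)
  then show "\<forall>\<^sub>F y in nhds z. c < lower_limit F u y"
  proof eventually_elim
    case (elim y)
    have "\<forall>\<^sub>F (i, y) in F \<times>\<^sub>F nhds y. c' < u i y"
      unfolding eventually_prod_filter split_conv using PQ(1,3) elim by blast
    then have "c' \<le> lower_limit F u y"
      by (rule lower_limit_geI)
    then show ?case
      using c'(1) by simp
  qed
qed

text \<open>Near each point of \<open>K\<close> a constant separates \<open>\<psi>\<close> from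
  \<open>u i\<close> for all late \<open>i\<close>; finitely many such neighbourhoods cover
  \<open>K\<close>. This provides all the uniformity in the convergence result.\<close>

lemma lower_limit_compact:
  assumes "compact K" "continuous_on UNIV \<psi>" "\<And>z. z \<in> K \<Longrightarrow> \<psi> z < lower_limit F u z"
  shows "\<forall>\<^sub>F i in F. \<forall>z\<in>K. \<psi> z < u i z"
proof -
  define good where "good S \<longleftrightarrow> open S \<and> (\<forall>\<^sub>F i in F. \<forall>y\<in>S. \<psi> y < u i y)" for S
  have "\<exists>S. good S \<and> z \<in> S" if "z \<in> K" for z
  proof -
    have "\<psi> z < lower_limit F u z"
      by (rule assms(3)[OF that])
    then obtain c where c: "\<psi> z < c" "c < lower_limit F u z"
      using dense by blast
    from lower_limit_gtD[OF c(2)] obtain P Q where PQ: "eventually P F" "eventually Q (nhds z)"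
        "\<And>i y. P i \<Longrightarrow> Q y \<Longrightarrow> c < u i y"
      unfolding eventually_prod_filter split_conv by blast
    obtain S where S: "open S" "z \<in> S" "\<And>y. y \<in> S \<Longrightarrow> Q y"
      using PQ(2) unfolding eventually_nhds by blast
    have "open {y. \<psi> y < c}"
      by (intro open_Collect_less assms(2) continuous_on_const)
    then have "open (S \<inter> {y. \<psi> y < c})" "z \<in> S \<inter> {y. \<psi> y < c}"
      using S c(1) by auto
    moreover have "\<forall>\<^sub>F i in F. \<forall>y\<in>S \<inter> {y. \<psi> y < c}. \<psi> y < u i y"
      using PQ(1) by eventually_elim (use PQ(3) S(3) in force)
    ultimately show ?thesis
      unfolding good_def by blast
  qed
  then have "K \<subseteq> \<Union>{S. good S}"
    by blast
  moreover have "\<And>S. S \<in> {S. good S} \<Longrightarrow> open S"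
    by (simp add: good_def)
  ultimately obtain D where D: "D \<subseteq> {S. good S}" "finite D" "K \<subseteq> \<Union>D"
    using compactE[OF assms(1)] by metis
  have "\<forall>\<^sub>F i in F. \<forall>S\<in>D. \<forall>y\<in>S. \<psi> y < u i y"
    using D(1,2) by (intro eventually_ball_finite) (auto simp: good_def)
  then show ?thesis
    by eventually_elim (use D(3) in blast)
qed

end

section \<open>Stability of viscosity inequalities under half-relaxed limits\<close>

lemma le_if_le_linear:
  fixes a b k :: real
  assumes "\<And>\<epsilon>. 0 < \<epsilon> \<Longrightarrow> \<epsilon> < 1 \<Longrightarrow> a \<le> b + k * \<epsilon>"
  shows "a \<le> b"
proof (rule tendsto_lowerbound)
  have "((\<lambda>\<epsilon>. b + k * \<epsilon>) \<longlongrightarrow> b + k * 0) (at_right 0)"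
    by (intro tendsto_intros)
  then show "((\<lambda>\<epsilon>. b + k * \<epsilon>) \<longlongrightarrow> b) (at_right 0)"
    by simp
  show "\<forall>\<^sub>F \<epsilon> in at_right 0. a \<le> b + k * \<epsilon>"
    using assms eventually_at_right_less[of 0] eventually_at_right_real[of 0 1]
    by (auto elim: eventually_mono)
qed simp

text \<open>Subtracting the squared distance from the test function makes the minimum strict, so that
  minimizers of the approximations over a small ball stay in its interior.\<close>

lemma lower_limit_approximate_test:
  fixes u :: "'i \<Rightarrow> 'a::euclidean_space \<Rightarrow> real"
  assumes "\<forall>\<^sub>F i in F. \<forall>y. \<bar>u i y\<bar> \<le> B" "F \<noteq> bot" and P: "\<forall>\<^sub>F i in F. P i" "\<And>i. P i \<Longrightarrow> lsc (u i)"
    and \<phi>: "C1_with_gradient \<phi> g"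
    and min: "\<forall>\<^sub>F y in nhds z0. lower_limit F u z0 - \<phi> z0 \<le> lower_limit F u y - \<phi> y"
    and "\<epsilon> > 0"
  obtains i z \<psi> h where "P i" "dist z z0 < \<epsilon>" "u i z < lower_limit F u z0 + \<epsilon>"
    "C1_with_gradient \<psi> h" "norm (h z - g z0) < \<epsilon>"
    "\<forall>\<^sub>F y in nhds z. u i z - \<psi> z \<le> u i y - \<psi> y"
proof -
  define V where "V = lower_limit F u"
  define m where "m = V z0 - \<phi> z0"
  define \<psi> where "\<psi> y = \<phi> y + (- 1) * (norm (y - z0))\<^sup>2" for y
  define h where "h y = g y + (- 1) *\<^sub>R (2 *\<^sub>R (y - z0))" for y
  have \<psi>: "C1_with_gradient \<psi> h"
    unfolding \<psi>_def[abs_def] h_def[abs_def] by (intro C1_add C1_scale C1_norm_sq \<phi>)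
  have cont: "continuous_on UNIV \<phi>" "continuous_on UNIV \<psi>" "continuous_on UNIV h"
    using C1_imp_continuous[OF \<phi>] C1_imp_continuous[OF \<psi>] \<psi> by (auto simp: C1_with_gradient_def)
  have near: "\<forall>\<^sub>F y in nhds z0. dist (k y) (k z0) < e" if "continuous_on UNIV k" "e > 0"
    for k :: "'a \<Rightarrow> 'c::metric_space" and e
    by (rule tendstoD[OF continuous_on_UNIV_tendsto[OF that(1)] that(2)])
  have near_id: "\<forall>\<^sub>F y in nhds z0. dist y z0 < e" if "e > 0" for e
    using that by (auto simp: eventually_nhds_metric)
  have "\<forall>\<^sub>F y in nhds z0. m \<le> V y - \<phi> y \<and> dist (\<phi> y) (\<phi> z0) < \<epsilon> / 4 \<and> dist (h y) (h z0) < \<epsilon>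
      \<and> dist y z0 < \<epsilon>"
    using min \<open>\<epsilon> > 0\<close> unfolding m_def V_def
    by (intro eventually_conj near_id near cont) auto
  then obtain \<delta>' where "\<delta>' > 0" and \<delta>': "\<And>y. dist y z0 < \<delta>' \<Longrightarrow>
      m \<le> V y - \<phi> y \<and> dist (\<phi> y) (\<phi> z0) < \<epsilon> / 4 \<and> dist (h y) (h z0) < \<epsilon> \<and> dist y z0 < \<epsilon>"
    unfolding eventually_nhds_metric by blast
  define \<delta> where "\<delta> = \<delta>' / 2"
  have "\<delta> > 0" and \<delta>: "\<And>y. y \<in> cball z0 \<delta> \<Longrightarrow>
      m \<le> V y - \<phi> y \<and> dist (\<phi> y) (\<phi> z0) < \<epsilon> / 4 \<and> dist (h y) (h z0) < \<epsilon> \<and> dist y z0 < \<epsilon>"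
    using \<open>\<delta>' > 0\<close> \<delta>' by (auto simp: \<delta>_def dist_commute)
  \<comment> \<open>At the minimizer \<open>z\<close> below, the upper bound
    \<open>m + 2 * \<eta>\<close> and the lower bound \<open>m - \<eta>\<close> leave less than
    \<open>3 * \<eta>\<close> for the squared distance to \<open>z0\<close>, so \<open>z\<close> is
    interior. The bound by \<open>\<epsilon> / 4\<close> controls the value at
    \<open>z\<close>.\<close>
  define \<eta> where "\<eta> = min (\<delta>\<^sup>2 / 4) (\<epsilon> / 4)"
  have \<eta>: "\<eta> > 0" "3 * \<eta> < \<delta>\<^sup>2" "\<eta> \<le> \<epsilon> / 4"
    using \<open>\<delta> > 0\<close> \<open>\<epsilon> > 0\<close> by (auto simp: \<eta>_def min_def field_simps)
  have "\<forall>\<^sub>F i in F. \<forall>y\<in>cball z0 \<delta>. \<phi> y + m - \<eta> < u i y"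
  proof (intro lower_limit_compact[OF assms(1,2)] continuous_intros cont compact_cball)
    fix y assume "y \<in> cball z0 \<delta>"
    from \<delta>[OF this] show "\<phi> y + m - \<eta> < lower_limit F u y"
      using \<eta>(1) by (simp add: V_def)
  qed
  then have ev: "\<forall>\<^sub>F i in F. P i \<and> (\<forall>y\<in>cball z0 \<delta>. \<phi> y + m - \<eta> < u i y)"
    using P(1) by eventually_elim simp
  \<comment> \<open>\<open>V z0\<close> is the largest asymptotic lower bound at \<open>z0\<close>,
    so values at most \<open>V z0 + \<eta>\<close> occur for late indices arbitrarily near
    \<open>z0\<close>. Such a point bounds the minimum from above.\<close>
  have not_ev: "\<not> (\<forall>\<^sub>F (i, y) in F \<times>\<^sub>F nhds z0. V z0 + \<eta> < u i y)"
    using lower_limit_geI[OF assms(1,2)] \<eta>(1) by (fastforce simp: V_def)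
  have ev_y: "\<forall>\<^sub>F y in nhds z0. dist y z0 < \<delta> \<and> dist (\<psi> y) (\<psi> z0) < \<eta>"
    using \<open>\<delta> > 0\<close> \<eta>(1) by (intro eventually_conj near_id near cont) auto
  obtain i y where i: "P i" "\<forall>y\<in>cball z0 \<delta>. \<phi> y + m - \<eta> < u i y"
    and y: "dist y z0 < \<delta>" "dist (\<psi> y) (\<psi> z0) < \<eta>" "u i y \<le> V z0 + \<eta>"
  proof (rule ccontr)
    assume no: "\<not> thesis"
    have "\<forall>\<^sub>F (i, y) in F \<times>\<^sub>F nhds z0. V z0 + \<eta> < u i y"
      unfolding eventually_prod_filter split_conv
    proof (intro exI conjI allI impI, rule ev, rule ev_y)
      fix i y
      assume "P i \<and> (\<forall>y\<in>cball z0 \<delta>. \<phi> y + m - \<eta> < u i y)"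
        "dist y z0 < \<delta> \<and> dist (\<psi> y) (\<psi> z0) < \<eta>"
      then show "V z0 + \<eta> < u i y"
        using no that[of i y] by linarith
    qed
    with not_ev show False
      by blast
  qed
  have "lsc (\<lambda>z. u i z + - \<psi> z)"
    by (intro lsc_add P(2)[OF i(1)] continuous_imp_lsc continuous_intros cont)
  then obtain z where z: "z \<in> cball z0 \<delta>" "\<And>y. y \<in> cball z0 \<delta> \<Longrightarrow> u i z - \<psi> z \<le> u i y - \<psi> y"
    using lsc_attains_inf[of "\<lambda>z. u i z - \<psi> z" "cball z0 \<delta>"] \<open>\<delta> > 0\<close> by fastforce
  have le: "u i z - \<psi> z \<le> m + 2 * \<eta>"
  proof -
    have "u i z - \<psi> z \<le> u i y - \<psi> y"
      using y(1) by (intro z(2)) (simp add: dist_commute)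
    then show ?thesis
      using y(2,3) by (simp add: m_def dist_real_def \<psi>_def)
  qed
  have "(norm (z - z0))\<^sup>2 < \<delta>\<^sup>2"
    using le bspec[OF i(2) z(1)] \<eta>(2) by (simp add: \<psi>_def)
  then have "norm (z - z0) < \<delta>"
    using \<open>\<delta> > 0\<close> by (simp add: power2_less_imp_less)
  then have int: "z \<in> ball z0 \<delta>"
    by (simp add: dist_norm norm_minus_commute)
  show ?thesis
  proof (rule that[OF i(1) _ _ \<psi>])
    show "dist z z0 < \<epsilon>"
      using \<delta>[OF z(1)] by simp
    have "u i z \<le> m + 2 * \<eta> + \<phi> z"
      using le zero_le_power2[of "norm (z - z0)"] unfolding \<psi>_def by linarith
    moreover have "\<bar>\<phi> z - \<phi> z0\<bar> < \<epsilon> / 4"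
      using \<delta>[OF z(1)] by (simp add: dist_real_def)
    ultimately show "u i z < lower_limit F u z0 + \<epsilon>"
      using \<eta>(3) unfolding m_def V_def by linarith
    show "norm (h z - g z0) < \<epsilon>"
      using \<delta>[OF z(1)] by (simp add: dist_norm h_def)
    show "\<forall>\<^sub>F y in nhds z. u i z - \<psi> z \<le> u i y - \<psi> y"
      using z(2) int by (intro eventually_nhds_in_open[THEN eventually_mono, of "ball z0 \<delta>"]) auto
  qed
qed

text \<open>A test at \<open>z0\<close> is replaced by a test of some \<open>u i\<close> with point
  and gradient within \<open>\<epsilon>\<close> and value at most \<open>\<epsilon>\<close> higher;
  \<open>structured\<close> makes the resulting error linear in \<open>\<epsilon>\<close>.\<close>

theorem viscosity_supersolution_lower_limit:
  fixes u :: "'i \<Rightarrow> 'a::euclidean_space \<Rightarrow> real"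
  assumes "\<gamma> > 0" "M \<ge> 0" "C \<ge> 0" and H: "structured M C H"
    and bd: "\<forall>\<^sub>F i in F. \<forall>y. \<bar>u i y\<bar> \<le> B" "F \<noteq> bot"
    and sol: "\<forall>\<^sub>F i in F. lsc (u i) \<and> viscosity_supersolution (\<lambda>x s p. \<gamma> * s - H x p) (u i)"
  shows "viscosity_supersolution (\<lambda>x s p. \<gamma> * s - H x p) (lower_limit F u)"
  unfolding viscosity_supersolution_def
proof (intro allI impI, elim conjE)
  fix \<phi> g and z0 :: 'a
  assume \<phi>: "C1_with_gradient \<phi> g"
    and min: "\<forall>\<^sub>F y in nhds z0. lower_limit F u z0 - \<phi> z0 \<le> lower_limit F u y - \<phi> y"
  have "H z0 (g z0) \<le> \<gamma> * lower_limit F u z0 + (\<gamma> + M + C * (2 + norm (g z0))) * \<epsilon>"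
    if \<epsilon>: "0 < \<epsilon>" "\<epsilon> < 1" for \<epsilon>
  proof -
    obtain i z \<psi> h where i: "lsc (u i) \<and> viscosity_supersolution (\<lambda>x s p. \<gamma> * s - H x p) (u i)"
      and z: "dist z z0 < \<epsilon>" "u i z < lower_limit F u z0 + \<epsilon>"
      and h: "C1_with_gradient \<psi> h" "norm (h z - g z0) < \<epsilon>"
        "\<forall>\<^sub>F y in nhds z. u i z - \<psi> z \<le> u i y - \<psi> y"
      by (rule lower_limit_approximate_test[OF bd sol _ \<phi> min \<epsilon>(1)]) (blast, rule that)
    have "H z0 (g z0) \<le> H z (h z) + M * norm (g z0 - h z) + C * (1 + norm (h z)) * dist z0 z"
      using structuredD[OF H, of z0 "h z" "g z0 - h z" z] by simp
    also have "H z (h z) \<le> \<gamma> * u i z"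
      using conjunct2[OF i] h(1,3) unfolding viscosity_supersolution_def by fastforce
    also have "\<dots> \<le> \<gamma> * (lower_limit F u z0 + \<epsilon>)"
      using z(2) \<open>\<gamma> > 0\<close> by simp
    also have "M * norm (g z0 - h z) \<le> M * \<epsilon>"
      using h(2) \<open>M \<ge> 0\<close> by (simp add: norm_minus_commute mult_left_mono)
    also have "C * (1 + norm (h z)) * dist z0 z \<le> C * (2 + norm (g z0)) * \<epsilon>"
    proof -
      have "norm (h z) \<le> 1 + norm (g z0)"
        using h(2) \<epsilon>(2) norm_triangle_sub[of "h z" "g z0"] by linarith
      then show ?thesis
        using z(1) \<open>C \<ge> 0\<close> by (intro mult_mono) (auto simp: dist_commute)
    qed
    finally show ?thesis
      by (simp add: algebra_simps)
  qed
  from le_if_le_linear[OF this] show "0 \<le> \<gamma> * lower_limit F u z0 - H z0 (g z0)"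
    by simp
qed

text \<open>Changing the sign of solution and test function exchanges the two inequalities and turns
  \<open>H x p\<close> into \<open>- H x (- p)\<close>. This transfers stability from supersolutions
  to subsolutions.\<close>

lemma viscosity_subsolution_iff_uminus:
  "viscosity_subsolution (\<lambda>x s p. \<gamma> * s - H x p) u \<longleftrightarrow>
   viscosity_supersolution (\<lambda>x s p. \<gamma> * s - (- H x (- p))) (\<lambda>x. - u x)"
proof
  assume L: "viscosity_subsolution (\<lambda>x s p. \<gamma> * s - H x p) u"
  show "viscosity_supersolution (\<lambda>x s p. \<gamma> * s - (- H x (- p))) (\<lambda>x. - u x)"
    unfolding viscosity_supersolution_def
  proof (intro allI impI, elim conjE)
    fix \<phi> g x
    assume "C1_with_gradient \<phi> g" "\<forall>\<^sub>F y in nhds x. - u x - \<phi> x \<le> - u y - \<phi> y"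
    then have "C1_with_gradient (\<lambda>x. - \<phi> x) (\<lambda>x. - g x)" "\<forall>\<^sub>F y in nhds x. u y - - \<phi> y \<le> u x - - \<phi> x"
      by (auto intro: C1_minus elim: eventually_mono)
    then have "\<gamma> * u x - H x (- g x) \<le> 0"
      using L unfolding viscosity_subsolution_def by blast
    then show "0 \<le> \<gamma> * - u x - (- H x (- g x))"
      by simp
  qed
next
  assume R: "viscosity_supersolution (\<lambda>x s p. \<gamma> * s - (- H x (- p))) (\<lambda>x. - u x)"
  show "viscosity_subsolution (\<lambda>x s p. \<gamma> * s - H x p) u"
    unfolding viscosity_subsolution_def
  proof (intro allI impI, elim conjE)
    fix \<phi> g x
    assume "C1_with_gradient \<phi> g" "\<forall>\<^sub>F y in nhds x. u y - \<phi> y \<le> u x - \<phi> x"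
    then have "C1_with_gradient (\<lambda>x. - \<phi> x) (\<lambda>x. - g x)" "\<forall>\<^sub>F y in nhds x. - u x - - \<phi> x \<le> - u y - - \<phi> y"
      by (auto intro: C1_minus elim: eventually_mono)
    then have "0 \<le> \<gamma> * - u x - (- H x (- (- g x)))"
      using R unfolding viscosity_supersolution_def by blast
    then show "\<gamma> * u x - H x (g x) \<le> 0"
      by simp
  qed
qed

lemma structured_uminus:
  assumes "structured M C H"
  shows "structured M C (\<lambda>x p. - H x (- p))"
  unfolding structured_def
proof (intro allI)
  fix x y p q
  \<comment> \<open>Point and gradient are changed one after the other; changing both at once would
    put \<open>norm (p + q)\<close> instead of \<open>norm p\<close> into the last term.\<close>
  have "H y (- p) \<le> H x (- p) + C * (1 + norm p) * dist x y"
    using structuredD[OF assms, of y "- p" 0 x] by (simp add: dist_commute)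
  moreover have "H x (- p) \<le> H x (- (p + q)) + M * norm q"
    using structuredD[OF assms, of x "- (p + q)" q x] by simp
  ultimately show "- H x (- (p + q)) \<le> - H y (- p) + M * norm q + C * (1 + norm p) * dist x y"
    by linarith
qed

theorem viscosity_subsolution_upper_limit:
  fixes u :: "'i \<Rightarrow> 'a::euclidean_space \<Rightarrow> real"
  assumes "\<gamma> > 0" "M \<ge> 0" "C \<ge> 0" and H: "structured M C H"
    and bd: "\<forall>\<^sub>F i in F. \<forall>y. \<bar>u i y\<bar> \<le> B" "F \<noteq> bot"
    and sol: "\<forall>\<^sub>F i in F. lsc (\<lambda>x. - u i x) \<and> viscosity_subsolution (\<lambda>x s p. \<gamma> * s - H x p) (u i)"
  shows "viscosity_subsolution (\<lambda>x s p. \<gamma> * s - H x p) (upper_limit F u)"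
proof -
  have "viscosity_supersolution (\<lambda>x s p. \<gamma> * s - (- H x (- p))) (lower_limit F (\<lambda>i x. - u i x))"
    using bd(1) sol
    by (intro viscosity_supersolution_lower_limit[OF assms(1-3) structured_uminus[OF H] _ bd(2)])
      (simp_all add: viscosity_subsolution_iff_uminus)
  then show ?thesis
    by (simp add: viscosity_subsolution_iff_uminus upper_limit_def[abs_def])
qed

section \<open>Monotonicity, translation and equations on product spaces\<close>

lemma viscosity_subsolution_mono:
  assumes "viscosity_subsolution F u" "\<And>x s p. G x s p \<le> F x s p"
  shows "viscosity_subsolution G u"
  using assms unfolding viscosity_subsolution_def by (meson order_trans)

lemma viscosity_supersolution_mono:
  assumes "viscosity_supersolution F u" "\<And>x s p. F x s p \<le> G x s p"
  shows "viscosity_supersolution G u"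
  using assms unfolding viscosity_supersolution_def by (meson order_trans)

lemma viscosity_subsolution_shift:
  assumes "viscosity_subsolution F u"
  shows "viscosity_subsolution (\<lambda>x. F (x + c)) (\<lambda>x. u (x + c))"
  unfolding viscosity_subsolution_def
proof (intro allI impI, elim conjE)
  fix \<phi> g x
  assume \<phi>: "C1_with_gradient \<phi> g" and max: "\<forall>\<^sub>F y in nhds x. u (y + c) - \<phi> y \<le> u (x + c) - \<phi> x"
  have "filterlim (\<lambda>y. y - c) (nhds x) (nhds (x + c))"
    using continuous_on_UNIV_tendsto[of "\<lambda>y. y - c" "x + c"] by (simp add: continuous_intros)
  from eventually_compose_filterlim[OF max this]
  have "\<forall>\<^sub>F y in nhds (x + c). u y - \<phi> (y + - c) \<le> u (x + c) - \<phi> (x + c + - c)"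
    by simp
  with assms C1_shift[OF \<phi>, of "- c"] have "F (x + c) (u (x + c)) (g (x + c + - c)) \<le> 0"
    unfolding viscosity_subsolution_def by blast
  then show "F (x + c) (u (x + c)) (g x) \<le> 0"
    by simp
qed

lemma norm_fst_le_norm: "norm (fst p) \<le> norm p"
  by (metis norm_fst_le prod.collapse)

lemma norm_snd_le_norm: "norm (snd p) \<le> norm p"
  by (metis norm_snd_le prod.collapse)

lemma structured_add_norm_snd:
  fixes G :: "'a::euclidean_space \<times> 'b::euclidean_space \<Rightarrow> 'a \<Rightarrow> real"
  assumes G: "\<And>z z' p q. G z (p + q) \<le> G z' p + M * norm q + C * (1 + norm p) * dist z z'"
    and "M \<ge> 0" "C \<ge> 0" "L \<ge> 0"
  shows "structured (M + L) C (\<lambda>z p. G z (fst p) + L * norm (snd p))"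
  unfolding structured_def
proof (intro allI)
  fix z z' p q :: "'a \<times> 'b"
  have "G z (fst (p + q)) \<le> G z' (fst p) + M * norm (fst q) + C * (1 + norm (fst p)) * dist z z'"
    using G by simp
  moreover have "M * norm (fst q) \<le> M * norm q"
    using \<open>M \<ge> 0\<close> by (intro mult_left_mono norm_fst_le_norm)
  moreover have "C * (1 + norm (fst p)) * dist z z' \<le> C * (1 + norm p) * dist z z'"
    using \<open>C \<ge> 0\<close> by (intro mult_left_mono mult_right_mono add_left_mono norm_fst_le_norm) auto
  moreover have "L * norm (snd (p + q)) \<le> L * (norm (snd p) + norm q)"
    using \<open>L \<ge> 0\<close> norm_triangle_ineq[of "snd p" "snd q"] norm_snd_le_norm[of q]
    by (intro mult_left_mono) auto
  ultimately show "G z (fst (p + q)) + L * norm (snd (p + q))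
      \<le> G z' (fst p) + L * norm (snd p) + (M + L) * norm q + C * (1 + norm p) * dist z z'"
    by (simp add: distrib_left distrib_right)
qed

lemma eventually_nhds_fst:
  "(\<forall>\<^sub>F z in nhds (x, b). P (fst z)) \<longleftrightarrow> (\<forall>\<^sub>F y in nhds x. P y)"
  using eventually_prod1[of "nhds b" P "nhds x"] by (simp add: nhds_prod case_prod_unfold)

text \<open>Along \<open>principal S\<close> the lower limit is the lower semicontinuous envelope of
  the infimum over \<open>S\<close>; in this form it produces the envelopes of suprema over controls
  and over rates.\<close>

lemma lower_limit_principal_le:
  assumes "\<forall>\<^sub>F i in principal S. \<forall>y. \<bar>u i y\<bar> \<le> B" "i \<in> S"
  shows "lower_limit (principal S) u z \<le> u i z"
proof (rule dense_le)
  fix c assume "c < lower_limit (principal S) u z"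
  moreover have "principal S \<noteq> bot"
    using assms(2) by (auto simp: principal_eq_bot_iff)
  ultimately have "\<forall>\<^sub>F (i, y) in principal S \<times>\<^sub>F nhds z. c < u i y"
    using lower_limit_gtD[OF assms(1)] by blast
  from eventually_eventually_prod_filter1[OF this] have "\<forall>\<^sub>F y in nhds z. c < u i y"
    using assms(2) by (simp add: eventually_principal)
  then show "c \<le> u i z"
    using eventually_nhds_x_imp_x by fastforce
qed

text \<open>Penalizing with \<open>\<epsilon>\<close> times \<^const>\<open>jnorm\<close> in the second variable forces the minimizer to lie over
  \<open>b\<close>, the only point where that penalty has zero gradient.\<close>

lemma independent_of_snd:
  fixes v :: "'a::euclidean_space \<times> 'b::euclidean_space \<Rightarrow> real"
  assumes "lsc v" and B: "\<And>z. \<bar>v z\<bar> \<le> B"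
    and grad: "\<And>\<phi> g z. C1_with_gradient \<phi> g \<Longrightarrow> (\<And>y. v z - \<phi> z \<le> v y - \<phi> y) \<Longrightarrow> snd (g z) = 0"
  shows "v (x, a) = v (x, b)"
proof -
  have "v (x, b) \<le> v (x, a)" for a b
  proof (rule dense_le)
    fix c assume c: "c < v (x, b)"
    have "lsc (\<lambda>y. v (y, b))"
      by (intro lsc_compose[OF assms(1)] continuous_intros)
    from lscD[OF this c] obtain \<delta> where \<delta>: "\<delta> > 0" "\<And>y. dist y x < \<delta> \<Longrightarrow> c < v (y, b)"
      unfolding eventually_nhds_metric by blast
    have "B \<ge> 0"
      using B[of "(x, a)"] by linarith
    show "c \<le> v (x, a)"
    proof (rule le_if_le_linear)
      fix \<epsilon> :: real assume \<epsilon>: "0 < \<epsilon>" "\<epsilon> < 1"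
      \<comment> \<open>The value of \<open>K * \<delta>\<^sup>2\<close> exceeds the largest
        possible oscillation \<open>2 * B\<close> of \<open>v\<close>, so the minimizer stays within
        \<open>\<delta>\<close> of \<open>x\<close>.\<close>
      define K where "K = (2 * B + 1) / \<delta>\<^sup>2"
      have K: "K > 0" "K * \<delta>\<^sup>2 = 2 * B + 1"
        using \<open>B \<ge> 0\<close> \<delta>(1) by (simp_all add: K_def)
      define \<psi> where "\<psi> z = K * (norm (fst z - x))\<^sup>2 + \<epsilon> * jnorm (snd z - b)" for z :: "'a \<times> 'b"
      define h where "h z = - (K *\<^sub>R (2 *\<^sub>R (fst z - x), 0) +
          \<epsilon> *\<^sub>R (0, inverse (jnorm (snd z - b)) *\<^sub>R (snd z - b)))" for z :: "'a \<times> 'b"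
      have \<psi>: "C1_with_gradient (\<lambda>z. - \<psi> z) h"
        unfolding \<psi>_def h_def
        by (intro C1_minus C1_add C1_scale C1_fst[OF C1_norm_sq] C1_snd[OF C1_jnorm])
      have "\<exists>z. \<forall>y. v z + \<psi> z \<le> v y + \<psi> y"
      proof (rule lsc_attains_inf_UNIV)
        show "lsc (\<lambda>z. v z + \<psi> z)"
          unfolding \<psi>_def by (intro lsc_add assms(1) continuous_imp_lsc continuous_intros)
        have "norm (y - x) \<le> sqrt ((2 * B + \<epsilon>) / K) \<and> norm (d - b) \<le> (2 * B + \<epsilon>) / \<epsilon>"
          if "v (y, d) + \<psi> (y, d) \<le> v (x, b) + \<psi> (x, b)" for y d
        proof -
          have le: "K * (norm (y - x))\<^sup>2 + \<epsilon> * jnorm (d - b) \<le> 2 * B + \<epsilon>"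
            using that B[of "(y, d)"] B[of "(x, b)"] by (simp add: \<psi>_def jnorm_0)
          moreover have "0 \<le> K * (norm (y - x))\<^sup>2" "0 \<le> \<epsilon> * jnorm (d - b)"
            using K(1) \<epsilon>(1) jnorm_pos[of "d - b"] by simp_all
          ultimately have "K * (norm (y - x))\<^sup>2 \<le> 2 * B + \<epsilon>" "\<epsilon> * jnorm (d - b) \<le> 2 * B + \<epsilon>"
            by linarith+
          then have "(norm (y - x))\<^sup>2 \<le> (2 * B + \<epsilon>) / K" "jnorm (d - b) \<le> (2 * B + \<epsilon>) / \<epsilon>"
            using K(1) \<epsilon>(1) by (simp_all add: pos_le_divide_eq mult.commute)
          then show ?thesis
            using norm_less_jnorm[of "d - b"] by (auto intro: real_le_rsqrt)
        qed
        then have "{z. v z + \<psi> z \<le> v (x, b) + \<psi> (x, b)}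
            \<subseteq> cball x (sqrt ((2 * B + \<epsilon>) / K)) \<times> cball b ((2 * B + \<epsilon>) / \<epsilon>)"
          by (auto simp: dist_norm norm_minus_commute)
        then show "bounded {z. v z + \<psi> z \<le> v (x, b) + \<psi> (x, b)}"
          by (rule bounded_subset[rotated]) (intro bounded_Times bounded_cball)
      qed
      then obtain y d where min: "\<And>z. v (y, d) + \<psi> (y, d) \<le> v z + \<psi> z"
        by auto
      have "snd (h (y, d)) = 0"
        using min by (intro grad[OF \<psi>]) simp
      then have "d = b"
        using \<epsilon>(1) jnorm_pos[of "d - b"] by (simp add: h_def)
      have "K * (norm (y - x))\<^sup>2 \<le> 2 * B"
        using min[of "(x, b)"] B[of "(y, d)"] B[of "(x, b)"] by (simp add: \<psi>_def \<open>d = b\<close>)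
      then have "K * (norm (y - x))\<^sup>2 < K * \<delta>\<^sup>2"
        using K(2) by simp
      then have "(norm (y - x))\<^sup>2 < \<delta>\<^sup>2"
        using K(1) by simp
      then have "norm (y - x) < \<delta>"
        using \<delta>(1) by (simp add: power2_less_imp_less)
      then have "c < v (y, b)"
        by (intro \<delta>(2)) (simp add: dist_norm)
      moreover have "0 \<le> \<psi> (y, d)"
        unfolding \<psi>_def using K(1) \<epsilon>(1) jnorm_pos[of "d - b"] by simp
      \<comment> \<open>At the competitor \<open>(x, a)\<close> the quadratic penalty vanishes, so
        the loss is linear in \<open>\<epsilon>\<close> and disappears in the limit.\<close>
      moreover have "\<psi> (x, a) = jnorm (a - b) * \<epsilon>"
        by (simp add: \<psi>_def)
      ultimately show "c \<le> v (x, a) + jnorm (a - b) * \<epsilon>"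
        using min[of "(x, a)"] \<open>d = b\<close> by simp
    qed
  qed
  then show ?thesis
    by (simp add: antisym)
qed

subsection \<open>The control problem\<close>

locale control_data =
  fixes f :: "(real^'n) \<times> (real^'m) \<Rightarrow> real^'n" and r :: "(real^'n) \<times> (real^'m) \<Rightarrow> real"
    and \<gamma> M R C :: real
  assumes f_bound: "norm (f z) \<le> M" and r_bound: "\<bar>r z\<bar> \<le> R"
    and f_lipschitz: "norm (f z - f z') \<le> C * dist z z'" and r_lipschitz: "\<bar>r z - r z'\<bar> \<le> C * dist z z'"
    and C_nonneg: "C \<ge> 0" and \<gamma>_pos: "\<gamma> > 0"
begin

lemma M_nonneg: "M \<ge> 0"
  using f_bound[of undefined] norm_ge_zero order_trans by blast

lemma R_nonneg: "R \<ge> 0"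
  using r_bound[of undefined] by linarith

definition H :: "real^'n \<Rightarrow> real^'n \<Rightarrow> real" where
  "H x p = (SUP a. p \<bullet> f (x, a) + r (x, a))"

definition HL :: "real \<Rightarrow> (real^'n) \<times> (real^'m) \<Rightarrow> (real^'n) \<times> (real^'m) \<Rightarrow> real" where
  "HL L z p = fst p \<bullet> f z + r z + L * norm (snd p)"

lemma HJB_eq: "HJB f r \<gamma> = (\<lambda>x s p. \<gamma> * s - H x p)"
  by (simp add: HJB_def H_def)

lemma HJB_rate_limited_eq: "HJB_rate_limited f r \<gamma> L = (\<lambda>z s p. \<gamma> * s - HL L z p)"
  by (auto simp: HJB_rate_limited_def HL_def fun_eq_iff)

text \<open>The constants are independent of the control, so the estimate passes to the supremum
  over \<open>a\<close> as well as to the rate-limited equation.\<close>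

lemma hamiltonian_step:
  "(p + q) \<bullet> f z + r z \<le> p \<bullet> f z' + r z' + M * norm q + C * (1 + norm p) * dist z z'"
proof -
  have "(p + q) \<bullet> f z = p \<bullet> f z' + p \<bullet> (f z - f z') + q \<bullet> f z"
    by (simp add: inner_simps)
  moreover have "p \<bullet> (f z - f z') \<le> norm p * (C * dist z z')"
    by (meson norm_cauchy_schwarz f_lipschitz mult_left_mono norm_ge_zero order_trans)
  moreover have "q \<bullet> f z \<le> norm q * M"
    by (meson norm_cauchy_schwarz f_bound mult_left_mono norm_ge_zero order_trans)
  moreover have "r z \<le> r z' + C * dist z z'"
    using r_lipschitz[of z z'] by linarith
  ultimately show ?thesis
    by (simp add: algebra_simps)
qed

lemma bdd_above_H: "bdd_above (range (\<lambda>a. p \<bullet> f (x, a) + r (x, a)))"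
proof (rule bdd_aboveI2)
  fix a
  have "p \<bullet> f (x, a) \<le> norm p * M"
    by (meson norm_cauchy_schwarz f_bound mult_left_mono norm_ge_zero order_trans)
  then show "p \<bullet> f (x, a) + r (x, a) \<le> norm p * M + R"
    using r_bound[of "(x, a)"] by linarith
qed

lemma le_H: "p \<bullet> f (x, a) + r (x, a) \<le> H x p"
  unfolding H_def by (rule cSUP_upper[OF UNIV_I bdd_above_H])

lemma structured_H: "structured M C H"
  unfolding structured_def
proof (intro allI)
  fix x y p q
  have "(p + q) \<bullet> f (x, a) + r (x, a) \<le> H y p + M * norm q + C * (1 + norm p) * dist x y" for a
    using hamiltonian_step[of p q "(x, a)" "(y, a)"] le_H[of p y a] by (simp add: dist_Pair_Pair)
  then show "H x (p + q) \<le> H y p + M * norm q + C * (1 + norm p) * dist x y"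
    unfolding H_def[of x] by (intro cSUP_least) auto
qed

lemma structured_HL:
  assumes "L \<ge> 0"
  shows "structured (M + L) C (HL L)"
  unfolding HL_def[abs_def]
  by (rule structured_add_norm_snd[OF hamiltonian_step M_nonneg C_nonneg assms])

text \<open>The limit Hamiltonian lifted to pairs, with the rate term kept: the common equation for
  all translates of a rate-limited solution in the control variable.\<close>

lemma structured_H_fst:
  assumes "L \<ge> 0"
  shows "structured (M + L) C (\<lambda>z p. H (fst z) (fst p) + L * norm (snd p :: real^'m))"
proof (rule structured_add_norm_snd[OF _ M_nonneg C_nonneg assms])
  fix z z' :: "(real^'n) \<times> (real^'m)" and p q :: "real^'n"
  have "C * (1 + norm p) * dist (fst z) (fst z') \<le> C * (1 + norm p) * dist z z'"
    using C_nonneg by (intro mult_left_mono dist_fst_le) auto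
  then show "H (fst z) (p + q) \<le> H (fst z') p + M * norm q + C * (1 + norm p) * dist z z'"
    using structuredD[OF structured_H, of "fst z" p q "fst z'"] by linarith
qed

text \<open>At zero gradient the Hamiltonian is \<open>r\<close>, so the constants
  \<open>R / \<gamma>\<close> and \<open>- (R / \<gamma>)\<close> are a super- and a subsolution.
  The bound is uniform in \<open>L\<close>.\<close>

lemma rate_limited_bound:
  assumes "L > 0" and Q: "bounded_continuous_viscosity_solution (HJB_rate_limited f r \<gamma> L) Q"
  shows "\<bar>Q z\<bar> \<le> R / \<gamma>"
proof -
  obtain B where B: "\<And>z. \<bar>Q z\<bar> \<le> B"
    using Q unfolding bounded_continuous_viscosity_solution_def bounded_iff by auto
  define B' where "B' = max B (R / \<gamma>)"
  have B': "Q z \<le> B'" "- B' \<le> Q z" "R / \<gamma> \<le> B'" "- B' \<le> R / \<gamma>" "- (R / \<gamma>) \<le> B'" for z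
  proof -
    have "0 \<le> R / \<gamma>"
      using R_nonneg \<gamma>_pos by simp
    then show "Q z \<le> B'" "- B' \<le> Q z" "R / \<gamma> \<le> B'" "- B' \<le> R / \<gamma>" "- (R / \<gamma>) \<le> B'"
      using B[of z] unfolding B'_def by linarith+
  qed
  have cont: "continuous_on UNIV Q"
    and sub: "viscosity_subsolution (\<lambda>z s p. \<gamma> * s - HL L z p) Q"
    and super: "viscosity_supersolution (\<lambda>z s p. \<gamma> * s - HL L z p) Q"
    using Q by (simp_all add: bounded_continuous_viscosity_solution_def HJB_rate_limited_eq)
  have r: "HL L z 0 \<le> \<gamma> * (R / \<gamma>)" "\<gamma> * (- (R / \<gamma>)) \<le> HL L z 0" for z
    using r_bound[of z] \<gamma>_pos by (auto simp: HL_def)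
  have "0 \<le> M + L"
    using M_nonneg \<open>L > 0\<close> by simp
  note cmp = comparison[OF \<gamma>_pos this C_nonneg structured_HL[OF less_imp_le[OF \<open>L > 0\<close>]]]
  have "Q z \<le> R / \<gamma>"
    by (rule cmp[where B = B'])
      (use B' in \<open>auto intro!: continuous_imp_lsc continuous_intros cont sub viscosity_supersolution_const r\<close>)
  moreover have "- (R / \<gamma>) \<le> Q z"
    by (rule cmp[where B = B'])
      (use B' in \<open>auto intro!: continuous_imp_lsc continuous_intros cont super viscosity_subsolution_const r
        simp del: mult_minus_right\<close>)
  ultimately show ?thesis
    by linarith
qed

text \<open>Every translate of \<open>Q\<close> in the control variable is a subsolution of the
  equation with the lifted \<open>H\<close>, since \<open>H\<close> dominates each single control.
  Hence so is their upper limit, which depends on \<open>x\<close> alone; tests in \<open>x\<close>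
  alone remove the rate term.\<close>

lemma upper_limit_subsolution:
  assumes "L > 0" and Q: "bounded_continuous_viscosity_solution (HJB_rate_limited f r \<gamma> L) Q"
  shows "viscosity_subsolution (HJB f r \<gamma>) (upper_limit (principal UNIV) (\<lambda>a x. Q (x, a)))"
proof -
  define W where "W = upper_limit (principal UNIV) (\<lambda>a x. Q (x, a))"
  define u where "u a z = Q (z + (0, a))" for a z
  have "upper_limit (principal UNIV) u z = W (fst z)" for z
  proof -
    have "(\<forall>\<^sub>F (a, y) in principal UNIV \<times>\<^sub>F nhds z. c < - u a y) \<longleftrightarrow>
        (\<forall>\<^sub>F (a, x) in principal UNIV \<times>\<^sub>F nhds (fst z). c < - Q (x, a))" for c
    proof -
      \<comment> \<open>For fixed \<open>y\<close>, shifting by \<open>snd y\<close> permutes the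
        controls, so the condition over all translates sees only \<open>fst y\<close>.\<close>
      have *: "(\<forall>a. c < - u a y) \<longleftrightarrow> (\<forall>a. c < - Q (fst y, a))" for y
      proof -
        have "y + (0, a - snd y) = (fst y, a)" "y + (0, a) = (fst y, snd y + a)" for a
          by (simp_all add: prod_eq_iff)
        then show ?thesis
          unfolding u_def by metis
      qed
      have ev: "eventually P (principal UNIV \<times>\<^sub>F G) \<longleftrightarrow> (\<forall>\<^sub>F y in G. \<forall>a. P (a, y))"
        for P :: "'c \<times> 'd \<Rightarrow> bool" and G
      proof
        assume "eventually P (principal UNIV \<times>\<^sub>F G)"
        from eventually_eventually_prod_filter2[OF this] show "\<forall>\<^sub>F y in G. \<forall>a. P (a, y)"
          by (simp add: eventually_principal)
      qed (auto simp: eventually_prod_filter eventually_principal intro: exI[of _ "\<lambda>_. True"])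
      show ?thesis
        unfolding ev split_conv *
        using eventually_nhds_fst[of "\<lambda>x. \<forall>a. c < - Q (x, a)" "fst z" "snd z"] by simp
    qed
    then show ?thesis
      by (simp add: W_def upper_limit_def lower_limit_def)
  qed
  then have W: "upper_limit (principal UNIV) u = (\<lambda>z. W (fst z))"
    by blast
  define HW where "HW z p = H (fst z) (fst p) + L * norm (snd p)" for z p :: "(real^'n) \<times> (real^'m)"
  have HW: "structured (M + L) C HW"
    using structured_H_fst[OF less_imp_le[OF \<open>L > 0\<close>]] by (simp add: HW_def[abs_def])
  have cont: "continuous_on UNIV Q" and sub: "viscosity_subsolution (\<lambda>z s p. \<gamma> * s - HL L z p) Q"
    using Q by (simp_all add: bounded_continuous_viscosity_solution_def HJB_rate_limited_eq)
  have "viscosity_subsolution (\<lambda>z s p. \<gamma> * s - HW z p) (upper_limit (principal UNIV) u)"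
  proof (rule viscosity_subsolution_upper_limit[OF \<gamma>_pos _ C_nonneg HW, where B = "R / \<gamma>"])
    show "0 \<le> M + L"
      using M_nonneg \<open>L > 0\<close> by simp
    show "\<forall>\<^sub>F a in principal UNIV. \<forall>z. \<bar>u a z\<bar> \<le> R / \<gamma>"
      using rate_limited_bound[OF assms] by (simp add: u_def)
    show "principal UNIV \<noteq> (bot :: (real^'m) filter)"
      by (simp only: principal_eq_bot_iff UNIV_not_empty not_False_eq_True)
    have "lsc (\<lambda>z. - u a z)" for a
      unfolding u_def
      by (intro continuous_imp_lsc continuous_intros continuous_on_compose2[OF cont]) auto
    moreover have "viscosity_subsolution (\<lambda>z s p. \<gamma> * s - HW z p) (u a)" for a
    proof (rule viscosity_subsolution_mono)
      show "viscosity_subsolution (\<lambda>z s p. \<gamma> * s - HL L (z + (0, a)) p) (u a)"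
        using viscosity_subsolution_shift[OF sub] by (simp add: u_def[abs_def])
      show "\<gamma> * s - HW z p \<le> \<gamma> * s - HL L (z + (0, a)) p" for z s p
        using le_H[of "fst p" "fst z" "snd z + a"] by (cases z) (simp add: HW_def HL_def)
    qed
    ultimately show "\<forall>\<^sub>F a in principal UNIV. lsc (\<lambda>z. - u a z) \<and>
        viscosity_subsolution (\<lambda>z s p. \<gamma> * s - HW z p) (u a)"
      by simp
  qed
  then have sub_W: "viscosity_subsolution (\<lambda>z s p. \<gamma> * s - HW z p) (\<lambda>z. W (fst z))"
    by (simp only: W)
  show ?thesis
    unfolding HJB_eq viscosity_subsolution_def W_def[symmetric]
  proof (intro allI impI, elim conjE)
    fix \<phi> g x
    assume \<phi>: "C1_with_gradient \<phi> g" and max: "\<forall>\<^sub>F y in nhds x. W y - \<phi> y \<le> W x - \<phi> x"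
    \<comment> \<open>A test function of \<open>x\<close> is lifted to pairs; its gradient has
      second component 0, which annihilates \<open>L * norm (snd p)\<close>.\<close>
    have "\<forall>\<^sub>F z in nhds (x, 0). W (fst z) - \<phi> (fst z) \<le> W (fst (x, 0 :: real^'m)) - \<phi> (fst (x, 0 :: real^'m))"
      using max by (subst eventually_nhds_fst) simp
    with sub_W C1_fst[OF \<phi>] have "\<gamma> * W (fst (x, 0 :: real^'m)) -
        HW (x, 0) (g (fst (x, 0 :: real^'m)), 0) \<le> 0"
      unfolding viscosity_subsolution_def by blast
    then show "\<gamma> * W x - H x (g x) \<le> 0"
      by (simp add: HW_def)
  qed
qed

end

section \<open>The family of rate-limited solutions and its relaxed limits\<close>

locale control_family = control_data f r \<gamma> M R C
  for f :: "(real^'n) \<times> (real^'m) \<Rightarrow> real^'n" and r \<gamma> M R C +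
  fixes QL :: "real \<Rightarrow> (real^'n) \<times> (real^'m) \<Rightarrow> real"
  assumes QL: "L > 0 \<Longrightarrow> bounded_continuous_viscosity_solution (HJB_rate_limited f r \<gamma> L) (QL L)"
begin

lemma QL_bound: "L > 0 \<Longrightarrow> \<bar>QL L z\<bar> \<le> R / \<gamma>"
  using rate_limited_bound QL by blast

definition V :: "(real^'n) \<times> (real^'m) \<Rightarrow> real" where
  "V = lower_limit at_top QL"

definition W :: "real \<Rightarrow> real^'n \<Rightarrow> real" where
  "W L = upper_limit (principal UNIV) (\<lambda>a x. QL L (x, a))"

text \<open>An envelope over all positive rates instead of a limit at infinity, so that
  \<open>QL L (x, a) \<le> U x\<close> holds for every \<open>L > 0\<close>.\<close>

definition U :: "real^'n \<Rightarrow> real" where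
  "U = upper_limit (principal {0<..}) W"

lemma ev_QL_bound: "\<forall>\<^sub>F L in at_top. \<forall>z. \<bar>QL L z\<bar> \<le> R / \<gamma>"
  using eventually_gt_at_top[of 0] by eventually_elim (simp add: QL_bound)

lemmas V_rules = ev_QL_bound trivial_limit_at_top_linorder

lemma lsc_V: "lsc V"
  unfolding V_def by (rule lsc_lower_limit[OF V_rules])

lemma V_bound: "\<bar>V z\<bar> \<le> R / \<gamma>"
  unfolding V_def by (rule abs_lower_limit_le[OF V_rules])

text \<open>\<open>HL\<close> increases with the rate, so each \<open>QL i\<close> with
  \<open>i \<ge> L\<close> is a supersolution for rate \<open>L\<close>; stability applies with
  \<open>L\<close> fixed.\<close>

lemma V_supersolution:
  assumes "L > 0"
  shows "viscosity_supersolution (\<lambda>z s p. \<gamma> * s - HL L z p) V"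
  unfolding V_def
proof (rule viscosity_supersolution_lower_limit[OF \<gamma>_pos _ C_nonneg structured_HL V_rules])
  show "0 \<le> M + L" "0 \<le> L"
    using M_nonneg assms by simp_all
  show "\<forall>\<^sub>F i in at_top. lsc (QL i) \<and> viscosity_supersolution (\<lambda>z s p. \<gamma> * s - HL L z p) (QL i)"
    using eventually_ge_at_top[of L]
  proof eventually_elim
    case (elim i)
    then have i: "continuous_on UNIV (QL i)" "viscosity_supersolution (\<lambda>z s p. \<gamma> * s - HL i z p) (QL i)"
      using QL[of i] assms by (simp_all add: bounded_continuous_viscosity_solution_def HJB_rate_limited_eq)
    show ?case
    proof (intro conjI continuous_imp_lsc i viscosity_supersolution_mono[OF i(2)])
      show "\<gamma> * s - HL i z p \<le> \<gamma> * s - HL L z p" for z s p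
        using elim by (simp add: HL_def mult_right_mono)
    qed
  qed
qed

text \<open>The inequality holds for every rate with the same right-hand side, which forces the
  coefficient of \<open>L\<close> to vanish.\<close>

lemma V_test:
  assumes "C1_with_gradient \<phi> g" "\<forall>\<^sub>F y in nhds z. V z - \<phi> z \<le> V y - \<phi> y"
  shows "snd (g z) = 0" "fst (g z) \<bullet> f z + r z \<le> \<gamma> * V z"
proof -
  have *: "HL L z (g z) \<le> \<gamma> * V z" if "L > 0" for L
    using V_supersolution[OF that] assms unfolding viscosity_supersolution_def by fastforce
  define e where "e = \<gamma> * V z - (fst (g z) \<bullet> f z + r z)"
  have le: "L * norm (snd (g z)) \<le> e" if "L > 0" for L
    using *[OF that] by (simp add: HL_def e_def)
  show "snd (g z) = 0"
  proof (rule ccontr)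
    assume "snd (g z) \<noteq> 0"
    moreover define L where "L = (\<bar>e\<bar> + 1) / norm (snd (g z))"
    ultimately have "L > 0" "L * norm (snd (g z)) = \<bar>e\<bar> + 1"
      by (simp_all add: divide_pos_pos add_nonneg_pos)
    with le show False
      by force
  qed
  with le[of 1] show "fst (g z) \<bullet> f z + r z \<le> \<gamma> * V z"
    by (simp add: e_def)
qed

lemma V_independent: "V (x, a) = V (x, b)"
proof (rule independent_of_snd[OF lsc_V V_bound])
  show "snd (g z) = 0" if "C1_with_gradient \<phi> g" "\<And>y. V z - \<phi> z \<le> V y - \<phi> y" for \<phi> g z
    using that(2) by (intro V_test(1)[OF that(1)] always_eventually) blast
qed

text \<open>Because \<open>V\<close> is constant in the control, a test at \<open>x\<close> is a
  test at \<open>(x, a)\<close> for every \<open>a\<close>; the supremum over \<open>a\<close> of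
  the resulting inequalities is the claim.\<close>

lemma V_HJB_supersolution: "viscosity_supersolution (HJB f r \<gamma>) (\<lambda>x. V (x, 0))"
  unfolding HJB_eq viscosity_supersolution_def
proof (intro allI impI, elim conjE)
  fix \<phi> g x
  assume \<phi>: "C1_with_gradient \<phi> g" and min: "\<forall>\<^sub>F y in nhds x. V (x, 0) - \<phi> x \<le> V (y, 0) - \<phi> y"
  have "g x \<bullet> f (x, a) + r (x, a) \<le> \<gamma> * V (x, 0)" for a
  proof -
    have V0: "V z = V (fst z, 0)" for z
      using V_independent[of "fst z" "snd z" 0] by simp
    have "\<forall>\<^sub>F z in nhds (x, a). V (x, 0) - \<phi> x \<le> V (fst z, 0) - \<phi> (fst z)"
      using min by (subst eventually_nhds_fst)
    then have "\<forall>\<^sub>F z in nhds (x, a). V (x, a) - \<phi> (fst (x, a)) \<le> V z - \<phi> (fst z)"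
      by (simp add: V0[of "(x, a)"] V0[symmetric])
    from V_test(2)[OF C1_fst[OF \<phi>] this] show ?thesis
      by (simp add: V_independent[of x a 0])
  qed
  then have "H x (g x) \<le> \<gamma> * V (x, 0)"
    unfolding H_def by (intro cSUP_least) auto
  then show "0 \<le> \<gamma> * V (x, 0) - H x (g x)"
    by simp
qed

lemma W_bounds:
  assumes "L > 0"
  shows "lsc (\<lambda>x. - W L x)" "\<bar>W L x\<bar> \<le> R / \<gamma>" "QL L (x, a) \<le> W L x"
proof -
  have bd: "\<forall>\<^sub>F a in principal UNIV. \<forall>x. \<bar>- QL L (x, a)\<bar> \<le> R / \<gamma>"
    using QL_bound[OF assms] by simp
  have ne: "principal UNIV \<noteq> (bot :: (real^'m) filter)"
    by (simp only: principal_eq_bot_iff UNIV_not_empty not_False_eq_True)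
  show "lsc (\<lambda>x. - W L x)"
    using lsc_lower_limit[OF bd ne] by (simp add: W_def upper_limit_def)
  show "\<bar>W L x\<bar> \<le> R / \<gamma>"
    using abs_lower_limit_le[OF bd ne] by (simp add: W_def upper_limit_def)
  show "QL L (x, a) \<le> W L x"
    using lower_limit_principal_le[OF bd UNIV_I, of x a] by (simp add: W_def upper_limit_def)
qed

lemma U_bounds:
  shows "lsc (\<lambda>x. - U x)" "\<bar>U x\<bar> \<le> R / \<gamma>" "L > 0 \<Longrightarrow> QL L (x, a) \<le> U x"
proof -
  have bd: "\<forall>\<^sub>F L in principal {0<..}. \<forall>x. \<bar>- W L x\<bar> \<le> R / \<gamma>"
    using W_bounds(2) by (simp add: eventually_principal)
  have ne: "principal {0<..} \<noteq> (bot :: real filter)"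
    by (auto simp: principal_eq_bot_iff)
  show "lsc (\<lambda>x. - U x)"
    using lsc_lower_limit[OF bd ne] by (simp add: U_def upper_limit_def)
  show "\<bar>U x\<bar> \<le> R / \<gamma>"
    using abs_lower_limit_le[OF bd ne] by (simp add: U_def upper_limit_def)
  show "QL L (x, a) \<le> U x" if "L > 0"
    using lower_limit_principal_le[OF bd, of L x] W_bounds(3)[OF that, of x a] that
    by (simp add: U_def upper_limit_def)
qed

lemma U_subsolution: "viscosity_subsolution (HJB f r \<gamma>) U"
  unfolding HJB_eq U_def
proof (rule viscosity_subsolution_upper_limit[OF \<gamma>_pos M_nonneg C_nonneg structured_H, where B = "R / \<gamma>"])
  show "\<forall>\<^sub>F L in principal {0<..}. \<forall>x. \<bar>W L x\<bar> \<le> R / \<gamma>"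
    using W_bounds(2) by (simp add: eventually_principal)
  show "principal {0<..} \<noteq> (bot :: real filter)"
    by (auto simp: principal_eq_bot_iff)
  show "\<forall>\<^sub>F L in principal {0<..}. lsc (\<lambda>x. - W L x) \<and>
      viscosity_subsolution (\<lambda>x s p. \<gamma> * s - H x p) (W L)"
    using W_bounds(1) upper_limit_subsolution[OF _ QL]
    by (simp add: eventually_principal W_def[abs_def] HJB_eq)
qed

section \<open>Identification of the relaxed limits and locally uniform convergence\<close>

lemma HJB_comparison:
  assumes "lsc (\<lambda>x. - u x)" "bounded (range u)" "viscosity_subsolution (HJB f r \<gamma>) u"
    and "lsc v" "bounded (range v)" "viscosity_supersolution (HJB f r \<gamma>) v"
  shows "u x \<le> v x"
proof -
  obtain B B' where B: "\<And>x. \<bar>u x\<bar> \<le> B" "\<And>x. \<bar>v x\<bar> \<le> B'"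
    using assms(2,5) unfolding bounded_iff by auto
  show ?thesis
  proof (rule comparison[OF \<gamma>_pos M_nonneg C_nonneg structured_H assms(1) _ _ assms(4), where B = "max B B'"])
    show "u x \<le> max B B'" "- max B B' \<le> v x" for x
      using B(1)[of x] B(2)[of x] by linarith+
  qed (use assms in \<open>simp_all add: HJB_eq\<close>)
qed

lemma lsc_V0: "lsc (\<lambda>x. V (x, 0))"
  by (intro lsc_compose[OF lsc_V] continuous_intros)

lemma U_eq_V: "U x = V (x, a)"
proof -
  have "U x \<le> V (x, 0)"
    using U_bounds(2) V_bound
    by (intro HJB_comparison U_bounds(1) U_subsolution lsc_V0 V_HJB_supersolution) (auto simp: bounded_iff)
  \<comment> \<open>A level below the lower limit lies below \<open>QL L (x, a)\<close> for some
    positive \<open>L\<close>, and \<open>QL L\<close> never exceeds \<open>U\<close>.\<close>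
  moreover have "V (x, a) \<le> U x"
  proof (rule dense_le)
    fix c assume "c < V (x, a)"
    from lower_limit_gtD[OF V_rules this[unfolded V_def]]
    have "\<forall>\<^sub>F L in at_top. \<forall>\<^sub>F z in nhds (x, a). c < QL L z"
      using eventually_eventually_prod_filter1 by fastforce
    from eventually_happens'[OF trivial_limit_at_top_linorder
        eventually_conj[OF this eventually_gt_at_top[of 0]]]
    obtain L where L: "L > 0" "\<forall>\<^sub>F z in nhds (x, a). c < QL L z"
      by blast
    from eventually_nhds_x_imp_x[OF L(2)] U_bounds(3)[OF L(1), of x a] show "c \<le> U x"
      by linarith
  qed
  ultimately show ?thesis
    using V_independent[of x a 0] by linarith
qed

text \<open>\<open>U\<close> is an upper semicontinuous subsolution by construction and equals the
  lower semicontinuous supersolution \<open>V (x, 0)\<close>; continuity and both inequalities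
  follow.\<close>

lemma U_solution: "bounded_continuous_viscosity_solution (HJB f r \<gamma>) U"
proof -
  have U: "U = (\<lambda>x. V (x, 0))"
    using U_eq_V by blast
  have "lsc U" "viscosity_supersolution (HJB f r \<gamma>) U"
    unfolding U by (rule lsc_V0, rule V_HJB_supersolution)
  then show ?thesis
    unfolding bounded_continuous_viscosity_solution_def
    using U_bounds(2) by (auto simp: bounded_iff intro: lsc_imp_continuous U_bounds(1) U_subsolution)
qed

lemma HJB_solution_le:
  assumes P: "bounded_continuous_viscosity_solution (HJB f r \<gamma>) P"
    and Q: "bounded_continuous_viscosity_solution (HJB f r \<gamma>) Q"
  shows "P x \<le> Q x"
  using assms unfolding bounded_continuous_viscosity_solution_def
  by (intro HJB_comparison) (auto intro: continuous_imp_lsc continuous_intros)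

lemma HJB_solution_unique:
  assumes "bounded_continuous_viscosity_solution (HJB f r \<gamma>) Q"
  shows "Q = U"
  using HJB_solution_le[OF assms U_solution] HJB_solution_le[OF U_solution assms]
  by (intro ext antisym)

text \<open>The upper bound \<open>QL L \<le> U\<close> holds everywhere for every positive rate.
  Compactness enters only for the lower bound, where \<open>U - e\<close> lies strictly below the
  relaxed limit.\<close>

lemma uniform_limit_QL:
  assumes "compact K"
  shows "uniform_limit K QL (\<lambda>(x, a). U x) at_top"
  unfolding uniform_limit_iff
proof (intro allI impI)
  fix e :: real assume "e > 0"
  have cont: "continuous_on UNIV U"
    using U_solution by (simp add: bounded_continuous_viscosity_solution_def)
  have "continuous_on UNIV (\<lambda>z::(real^'n) \<times> (real^'m). U (fst z) - e)"
    by (intro continuous_on_diff continuous_on_const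
        continuous_on_compose2[OF cont continuous_on_fst[OF continuous_on_id]]) simp
  then have "\<forall>\<^sub>F L in at_top. \<forall>z\<in>K. U (fst z) - e < QL L z"
  proof (rule lower_limit_compact[OF V_rules assms])
    show "U (fst z) - e < lower_limit at_top QL z" for z
      using \<open>e > 0\<close> U_eq_V[of "fst z" "snd z"] by (simp add: V_def)
  qed
  then show "\<forall>\<^sub>F L in at_top. \<forall>z\<in>K. dist (QL L z) (case z of (x, a) \<Rightarrow> U x) < e"
    using eventually_gt_at_top[of 0]
  proof eventually_elim
    case (elim L)
    show ?case
    proof
      fix z assume "z \<in> K"
      then have "U (fst z) - e < QL L z"
        using elim(1) by blast
      moreover have "QL L z \<le> U (fst z)"
        using U_bounds(3)[OF elim(2), of "fst z" "snd z"] by simp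
      ultimately show "dist (QL L z) (case z of (x, a) \<Rightarrow> U x) < e"
        by (simp add: case_prod_unfold dist_real_def)
    qed
  qed
qed

end

theorem theorem4p2:
  fixes f :: "(real^'n) \<times> (real^'m) \<Rightarrow> real^'n"
    and r :: "(real^'n) \<times> (real^'m) \<Rightarrow> real"
    and \<gamma> :: real
    and QL :: "real \<Rightarrow> (real^'n) \<times> (real^'m) \<Rightarrow> real"
  assumes "bounded (range f)" and "\<exists>C. C-lipschitz_on UNIV f"
    and "bounded (range r)" and "\<exists>C. C-lipschitz_on UNIV r"
    and "\<gamma> > 0"
    and "\<And>L. L > 0 \<Longrightarrow> bounded_continuous_viscosity_solution (HJB_rate_limited f r \<gamma> L) (QL L)"
  shows "(\<exists>!Q. bounded_continuous_viscosity_solution (HJB f r \<gamma>) Q) \<and>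
    (\<forall>Q. bounded_continuous_viscosity_solution (HJB f r \<gamma>) Q \<longrightarrow>
      (\<forall>K. compact K \<longrightarrow> uniform_limit K QL (\<lambda>(x, a). Q x) at_top))"
proof -
  obtain M where M: "\<And>z. norm (f z) \<le> M"
    using assms(1) unfolding bounded_iff by auto
  obtain R where R: "\<And>z. \<bar>r z\<bar> \<le> R"
    using assms(3) unfolding bounded_iff by auto
  obtain Cf Cr where C: "Cf-lipschitz_on UNIV f" "Cr-lipschitz_on UNIV r"
    using assms(2,4) by blast
  define C where "C = max Cf Cr"
  have f: "C-lipschitz_on UNIV f" and r: "C-lipschitz_on UNIV r"
    unfolding C_def by (rule lipschitz_on_le[OF C(1)], simp, rule lipschitz_on_le[OF C(2)], simp)
  interpret control_family f r \<gamma> M R C QL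
  proof
    show "norm (f z - f z') \<le> C * dist z z'" "\<bar>r z - r z'\<bar> \<le> C * dist z z'" for z z'
      using lipschitz_onD[OF f UNIV_I UNIV_I, of z z'] lipschitz_onD[OF r UNIV_I UNIV_I, of z z']
      by (simp_all add: dist_norm)
    show "C \<ge> 0"
      by (rule lipschitz_on_nonneg[OF f])
  qed (use M R assms(5,6) in auto)
  show ?thesis
  proof (intro conjI allI impI)
    show "\<exists>!Q. bounded_continuous_viscosity_solution (HJB f r \<gamma>) Q"
      using U_solution HJB_solution_unique by (rule ex1I)
    fix Q K
    assume "bounded_continuous_viscosity_solution (HJB f r \<gamma>) Q" "compact (K :: ((real^'n) \<times> (real^'m)) set)"
    then show "uniform_limit K QL (\<lambda>(x, a). Q x) at_top"
      using uniform_limit_QL HJB_solution_unique by simp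
  qed
qed

end
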